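(* There is an absolute constant $c>0$ such that for every prime $p$, every connected component of the graph $\mathcal{X}_p$ has size (number of vertices) at least $c(\log p)^{7/9}$.
   Context: For a prime $p$, let $\mathbb{F}_p$ be the field of $p$ elements and let $\mathcal{M}_p$ be the set of triples $(x,y,z)\in\mathbb{F}_p^3\setminus\{(0,0,0)\}$ satisfying $x^2+y^2+z^2=3xyz$ in $\mathbb{F}_p$. The maps $$\mathcal{R}_1:(x,y,z)\mapsto(3yz-x,y,z),\quad \mathcal{R}_2:(x,y,z)\mapsto(x,3xz-y,z),\quad \mathcal{R}_3:(x,y,z)\mapsto(x,y,3xy-z)$$ are involutions of $\mathcal{M}_p$, and the permutations in $S_3$ of the three coordinates also map $\mathcal{M}_p$ to itself. The graph $\mathcal{X}_p$ has vertex set $\mathcal{M}_p$, with an edge from $v_1$ to $v_2$ whenever $v_2=T(v_1)$ for some $T\in\{\mathcal{R}_1,\mathcal{R}_2,\mathcal{R}_3\}\cup S_3$. Its connected components are the orbits of the group generated by these transformations. *)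

theory Defs
  imports
    Complex_Main
    "HOL-Number_Theory.Residues"
    "Graph_Theory.Digraph_Component"
begin

text \<open>The field with \<open>p\<close> elements (for prime \<open>p\<close>); its carrier is \<open>{0..p - 1}\<close>.\<close>

abbreviation GF :: "nat \<Rightarrow> int ring" where
  "GF p \<equiv> residue_ring (int p)"

definition markoff_triples :: "nat \<Rightarrow> (int \<times> int \<times> int) set" where
  "markoff_triples p = {(x, y, z).
     x \<in> carrier (GF p) \<and> y \<in> carrier (GF p) \<and> z \<in> carrier (GF p) \<and>
     (x, y, z) \<noteq> (\<zero>\<^bsub>GF p\<^esub>, \<zero>\<^bsub>GF p\<^esub>, \<zero>\<^bsub>GF p\<^esub>) \<and>
     x [^]\<^bsub>GF p\<^esub> (2::nat) \<oplus>\<^bsub>GF p\<^esub> y [^]\<^bsub>GF p\<^esub> (2::nat) \<oplus>\<^bsub>GF p\<^esub> z [^]\<^bsub>GF p\<^esub> (2::nat)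
       = [(3::nat)] \<cdot>\<^bsub>GF p\<^esub> (x \<otimes>\<^bsub>GF p\<^esub> y \<otimes>\<^bsub>GF p\<^esub> z)}"

fun R1 :: "nat \<Rightarrow> int \<times> int \<times> int \<Rightarrow> int \<times> int \<times> int" where
  "R1 p (x, y, z) = ([(3::nat)] \<cdot>\<^bsub>GF p\<^esub> (y \<otimes>\<^bsub>GF p\<^esub> z) \<ominus>\<^bsub>GF p\<^esub> x, y, z)"

fun R2 :: "nat \<Rightarrow> int \<times> int \<times> int \<Rightarrow> int \<times> int \<times> int" where
  "R2 p (x, y, z) = (x, [(3::nat)] \<cdot>\<^bsub>GF p\<^esub> (x \<otimes>\<^bsub>GF p\<^esub> z) \<ominus>\<^bsub>GF p\<^esub> y, z)"

fun R3 :: "nat \<Rightarrow> int \<times> int \<times> int \<Rightarrow> int \<times> int \<times> int" where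
  "R3 p (x, y, z) = (x, y, [(3::nat)] \<cdot>\<^bsub>GF p\<^esub> (x \<otimes>\<^bsub>GF p\<^esub> y) \<ominus>\<^bsub>GF p\<^esub> z)"

definition coord_perms :: "('a \<times> 'a \<times> 'a \<Rightarrow> 'a \<times> 'a \<times> 'a) set" where
  "coord_perms =
     {\<lambda>(x, y, z). (x, y, z), \<lambda>(x, y, z). (y, z, x), \<lambda>(x, y, z). (z, x, y),
      \<lambda>(x, y, z). (y, x, z), \<lambda>(x, y, z). (x, z, y), \<lambda>(x, y, z). (z, y, x)}"

definition markoff_moves :: "nat \<Rightarrow> (int \<times> int \<times> int \<Rightarrow> int \<times> int \<times> int) set" where
  "markoff_moves p = {R1 p, R2 p, R3 p} \<union> coord_perms"

definition markoff_graph :: "nat \<Rightarrow> (int \<times> int \<times> int) pair_pre_digraph" where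
  "markoff_graph p =
     \<lparr>pverts = markoff_triples p,
      parcs = {(v\<^sub>1, v\<^sub>2) \<in> markoff_triples p \<times> markoff_triples p. \<exists>T \<in> markoff_moves p. v\<^sub>2 = T v\<^sub>1}\<rparr>"

text \<open>
  A connected component is a maximal connected subgraph. The predicate \<open>connected\<close> of
  the graph library ignores the direction of arcs; its name is qualified because there is also
  a topological notion of that name.
\<close>

definition connected_component_of :: "('a, 'b) pre_digraph \<Rightarrow> ('a, 'b) pre_digraph \<Rightarrow> bool" where
  "connected_component_of H G \<longleftrightarrow> pre_digraph.max_subgraph G Digraph_Component.connected H"

end

theory Submission
  imports Defs "Jordan_Normal_Form.Char_Poly"
begin

text \<open>
  In fact the argument gives a lower bound of order \<open>log p\<close>.

  Let \<open>S\<close> be a component with \<open>N < p\<close> vertices. For a coordinate \<open>x\<close> of a triple in \<open>S\<close>, the rotation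
  \<open>(x, y, z) \<mapsto> (x, z, 3xz - y)\<close> permutes the triples of \<open>S\<close> over \<open>x\<close>; since it acts linearly on \<open>(y, z)\<close>
  with determinant 1 and trace \<open>X = 3x\<close>, finiteness forces \<open>X = \<xi> + 1/\<xi>\<close> for a root of unity \<open>\<xi>\<close>, and
  the order \<open>f(x)\<close> of \<open>\<xi>\<^sup>2\<close> is at most the number of triples of \<open>S\<close> over \<open>x\<close>. Such \<open>\<xi>\<close> are taken in
  characteristic 0 and reduced modulo a prime ideal above \<open>p\<close> of a cyclotomic ring.

  Let \<open>x\<close> maximise \<open>F = f(x)\<close>, and let \<open>y\<^sub>0, y\<^sub>1, \<dots>\<close> be the second coordinates along the rotation orbit.
  Eliminating the terms in between, \<open>y\<^sub>i\<close> and \<open>y\<^sub>j\<close> satisfy a quadratic relation over \<open>\<int>[\<xi>]\<close> whose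
  coefficients involve only \<open>\<xi>\<close> and \<open>\<xi>\<^sup>j\<^sup>-\<^sup>i\<close>. Its lift to characteristic 0 is a negative real number,
  because every lifted coordinate lies in \<open>[-2, 2]\<close>. If \<open>f(y\<^sub>i) = f(y\<^sub>j) = d\<close> with \<open>i < j < F\<close>, the lift lies
  in the field of \<open>2Fd\<close>-th roots of unity, and a product of its conjugates is a nonzero integer divisible
  by \<open>p\<close> and at most \<open>160\<^sup>2\<^sup>F\<^sup>d\<close>. Hence \<open>log p \<lless> F d\<close> for every order \<open>d\<close> that occurs twice among the
  \<open>F\<close> numbers \<open>f(y\<^sub>0), \<dots>, f(y\<^sub>F\<^sub>-\<^sub>1) \<in> {2, \<dots>, F}\<close>. By the pigeonhole principle their sum is of order
  at least \<open>log p\<close>, and it is at most \<open>2N\<close>, as every value occurs at most twice among the \<open>y\<^sub>i\<close>.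
\<close>

section \<open>Conjugates of cyclotomic integers\<close>

definition zeta :: "nat \<Rightarrow> complex" where
  "zeta n = cis (2 * pi / real n)"

lemma zeta_power: "n > 0 \<Longrightarrow> zeta n ^ n = 1"
  by (simp add: zeta_def DeMoivre)

lemma zeta_power_power: "n > 0 \<Longrightarrow> (zeta n ^ k) ^ n = 1"
  by (metis mult.commute power_mult power_one zeta_power)

lemma zeta_power_mod: "n > 0 \<Longrightarrow> zeta n ^ (k mod n) = zeta n ^ k"
  by (metis (no_types) div_mult_mod_eq mult.commute mult_1 power_add power_mult power_one zeta_power)

lemma zeta_power_eq_1_imp_dvd:
  assumes "n > 0" "zeta n ^ k = 1"
  shows "n dvd k"
proof (rule ccontr)
  assume "\<not> n dvd k"
  hence m: "k mod n \<noteq> 0" by (simp add: dvd_eq_mod_eq_0)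
  have "zeta n ^ (k mod n) = zeta n ^ 0" using assms zeta_power_mod by simp
  moreover have "zeta n ^ j = cis (2 * pi * real j / real n)" for j
    by (simp add: zeta_def DeMoivre mult_ac)
  ultimately have "k mod n = 0"
    using bij_betw_roots_unity[OF assms(1)] assms(1) m
    by (auto simp: bij_betw_def inj_on_def)
  thus False using m by simp
qed

lemma root_of_unity_eq_zeta_power:
  assumes "n > 0" "z ^ n = (1::complex)"
  obtains j where "j < n" "z = zeta n ^ j"
proof -
  have "z \<in> (\<lambda>k. cis (2 * pi * real k / real n)) ` {..<n}"
    using bij_betw_roots_unity[OF assms(1)] assms(2) by (simp add: bij_betw_def)
  thus ?thesis using that by (auto simp: zeta_def DeMoivre mult_ac)
qed

lemma sum_zeta_powers:
  assumes "n > 0"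
  shows "(\<Sum>j<n. (zeta n ^ j) ^ k) = (if n dvd k then of_nat n else 0)"
proof (cases "n dvd k")
  case True
  then obtain q where "k = n * q" by auto
  hence "zeta n ^ k = 1" using zeta_power[OF assms] by (simp add: power_mult)
  thus ?thesis using True by (simp flip: power_mult add: mult.commute[of _ k] power_mult)
next
  case False
  hence ne: "zeta n ^ k \<noteq> 1" using zeta_power_eq_1_imp_dvd assms by blast
  have "(zeta n ^ k) ^ n = 1" by (rule zeta_power_power[OF assms])
  hence "(\<Sum>j<n. (zeta n ^ k) ^ j) = 0" using ne by (simp add: geometric_sum)
  thus ?thesis using False by (simp flip: power_mult add: mult.commute[of _ k])
qed

text \<open>The values of \<open>f\<close> at the \<open>n\<close>-th roots of unity are the
  eigenvalues of an integer matrix, that of multiplication by \<open>f\<close> on \<int>[X]/(X^n -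
  1). So the monic polynomial with these roots is a characteristic polynomial over the
  integers.\<close>

lemma char_poly_circulant:
  fixes f :: "int poly"
  assumes n: "n > 0"
  shows "\<exists>g::int poly. of_int_poly g =
    (\<Prod>a<n. [: - poly (of_int_poly f) (zeta n ^ a), 1 :])"
proof -
  define ev where "ev a = poly (of_int_poly f) (zeta n ^ a)" for a
  \<comment> \<open>the circulant matrix of \<open>f\<close>, diagonalised by the discrete Fourier transform \<open>V\<close>\<close>
  define C :: "int mat" where
    "C = mat n n (\<lambda>(i, j). \<Sum>k\<le>Polynomial.degree f. if (i + k) mod n = j then Polynomial.coeff f k else 0)"
  define V :: "complex mat" where "V = mat n n (\<lambda>(i, a). zeta n ^ (i * a))"
  \<comment> \<open>\<open>W\<close> is the inverse transform; the exponent \<open>n - i\<close>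
    stands for \<open>-i\<close>.\<close>
  define W :: "complex mat" where "W = mat n n (\<lambda>(a, i). zeta n ^ ((n - i) * a) / of_nat n)"
  define D :: "complex mat" where "D = mat n n (\<lambda>(a, b). if a = b then ev a else 0)"
  let ?C = "map_mat of_int C :: complex mat"
  have carr: "?C \<in> carrier_mat n n" "V \<in> carrier_mat n n" "W \<in> carrier_mat n n" "D \<in> carrier_mat n n"
    by (auto simp: C_def V_def W_def D_def)
  have VW: "V * W = 1\<^sub>m n"
  proof (rule eq_matI)
    fix i j assume "i < dim_row (1\<^sub>m n :: complex mat)" "j < dim_col (1\<^sub>m n :: complex mat)"
    hence ij: "i < n" "j < n" by auto
    have "(V * W) $$ (i, j) = (\<Sum>a<n. zeta n ^ (i * a) * (zeta n ^ ((n - j) * a) / of_nat n))"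
      using ij carr by (simp add: times_mat_def scalar_prod_def V_def W_def atLeast0LessThan)
    also have "\<dots> = (\<Sum>a<n. (zeta n ^ a) ^ (i + (n - j))) / of_nat n"
      by (simp add: sum_divide_distrib algebra_simps power_add power_mult flip: power_mult)
    also have "\<dots> = (if n dvd i + (n - j) then 1 else 0)"
      using n by (simp add: sum_zeta_powers)
    also have "n dvd i + (n - j) \<longleftrightarrow> i = j"
    proof
      assume "n dvd i + (n - j)"
      then obtain q where q: "i + (n - j) = n * q" by auto
      have "q = 1"
      proof (rule ccontr)
        assume "q \<noteq> 1"
        hence "q = 0 \<or> q \<ge> 2" by auto
        thus False
        proof
          assume "q \<ge> 2"
          hence "n * q \<ge> n * 2" by (intro mult_left_mono) auto
          thus False using q ij by linarith
        qed (use q ij in auto)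
      qed
      thus "i = j" using q ij by auto
    qed (use ij in auto)
    finally show "(V * W) $$ (i, j) = 1\<^sub>m n $$ (i, j)" using ij by simp
  qed (use carr in auto)
  have WV: "W * V = 1\<^sub>m n"
    using mat_mult_left_right_inverse[OF carr(2,3) VW] .
  have CV: "?C * V = V * D"
  proof (rule eq_matI)
    fix i a assume "i < dim_row (V * D)" "a < dim_col (V * D)"
    hence ia: "i < n" "a < n" using carr by auto
    have "(?C * V) $$ (i, a) = (\<Sum>j<n. \<Sum>k\<le>Polynomial.degree f.
        (if (i + k) mod n = j then of_int (Polynomial.coeff f k) * zeta n ^ (j * a) else 0))"
      using ia carr
      by (simp add: times_mat_def scalar_prod_def V_def C_def atLeast0LessThan sum_distrib_right
          if_distrib[of of_int] if_distrib[of "\<lambda>x. x * _"] cong: if_cong)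
    also have "\<dots> = (\<Sum>k\<le>Polynomial.degree f. \<Sum>j<n.
        (if (i + k) mod n = j then of_int (Polynomial.coeff f k) * zeta n ^ (j * a) else 0))"
      by (rule sum.swap)
    also have "\<dots> = (\<Sum>k\<le>Polynomial.degree f. of_int (Polynomial.coeff f k) * zeta n ^ ((i + k) * a))"
    proof (rule sum.cong[OF refl])
      fix k
      have "(\<Sum>j<n. if (i + k) mod n = j then of_int (Polynomial.coeff f k) * zeta n ^ (j * a) else 0)
        = of_int (Polynomial.coeff f k) * (zeta n ^ ((i + k) mod n)) ^ a"
        using n by (simp add: power_mult)
      also have "\<dots> = of_int (Polynomial.coeff f k) * zeta n ^ ((i + k) * a)"
        using n by (simp add: zeta_power_mod power_mult)
      finally show "(\<Sum>j<n. if (i + k) mod n = j then of_int (Polynomial.coeff f k) * zeta n ^ (j * a) else 0)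
        = of_int (Polynomial.coeff f k) * zeta n ^ ((i + k) * a)" .
    qed
    also have "\<dots> = zeta n ^ (i * a) * ev a"
      by (simp add: ev_def poly_altdef sum_distrib_left power_add power_mult algebra_simps flip: power_mult)
    also have "\<dots> = (V * D) $$ (i, a)"
      using ia carr
      by (simp add: times_mat_def scalar_prod_def V_def D_def if_distrib[of "\<lambda>x. _ * x"] cong: if_cong)
    finally show "(?C * V) $$ (i, a) = (V * D) $$ (i, a)" .
  qed (use carr in auto)
  have "?C = ?C * (V * W)" using carr VW by simp
  also have "\<dots> = V * D * W" using assoc_mult_mat[OF carr(1-3)] CV by simp
  finally have "similar_mat ?C D"
    by (intro similar_matI[of _ _ V W n]) (use carr VW WV in auto)
  hence "char_poly ?C = char_poly D" by (rule char_poly_similar)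
  also have "char_poly D = (\<Prod> a \<leftarrow> diag_mat D. [:- a, 1:])"
    by (rule char_poly_upper_triangular[OF carr(4)]) (auto simp: D_def)
  also have "diag_mat D = map ev [0..<n]"
    by (auto simp: diag_mat_def D_def)
  also have "(\<Prod> a \<leftarrow> map ev [0..<n]. [:- a, 1:]) = (\<Prod>a<n. [:- ev a, 1:])"
    by (simp add: o_def prod.distinct_set_conv_list[symmetric] atLeast0LessThan)
  finally have "char_poly ?C = (\<Prod>a<n. [:- ev a, 1:])" .
  moreover have "C \<in> carrier_mat n n" by (simp add: C_def)
  hence "char_poly ?C = of_int_poly (char_poly C)"
    by (rule of_int_hom.char_poly_hom)
  ultimately show ?thesis unfolding ev_def by metis
qed

text \<open>Vanishing values contribute a power of X to the integer polynomial of
  \<open>char_poly_circulant\<close>, so the product is its lowest nonzero coefficient. Zeros are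
  left out because \<open>f\<close> may vanish at a non-primitive root without vanishing at
  \<open>zeta n\<close>.\<close>

lemma prod_nonzero_conjugates_int:
  fixes f :: "int poly"
  assumes n: "n > 0"
  shows "(\<Prod>a | a < n \<and> poly (of_int_poly f) (zeta n ^ a) \<noteq> 0.
            - poly (of_int_poly f) (zeta n ^ a)) \<in> \<int>"
proof -
  define ev where "ev a = poly (of_int_poly f) (zeta n ^ a)" for a
  obtain g :: "int poly" where g: "of_int_poly g = (\<Prod>a<n. [: - ev a, 1 :])"
    using char_poly_circulant[OF n, of f] unfolding ev_def by blast
  define A B where "A = {a. a < n \<and> ev a = 0}" and "B = {a. a < n \<and> ev a \<noteq> 0}"
  have AB: "{..<n} = A \<union> B" "A \<inter> B = {}" "finite A" "finite B"
    by (auto simp: A_def B_def)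
  have "(\<Prod>a<n. [: - ev a, 1 :]) = (\<Prod>a\<in>A. [: - ev a, 1 :]) * (\<Prod>a\<in>B. [: - ev a, 1 :])"
    using AB by (simp add: prod.union_disjoint)
  also have "(\<Prod>a\<in>A. [: - ev a, 1 :]) = (\<Prod>a\<in>A. [:0, 1:])"
    by (rule prod.cong) (auto simp: A_def)
  also have "\<dots> = Polynomial.monom 1 (card A)"
    by (simp add: monom_altdef)
  finally have "Polynomial.coeff (of_int_poly g) (card A) = Polynomial.coeff (\<Prod>a\<in>B. [: - ev a, 1 :]) 0"
    unfolding g by (simp add: coeff_monom_mult)
  also have "\<dots> = (\<Prod>a\<in>B. - ev a)"
    by (simp flip: poly_0_coeff_0 add: poly_prod)
  finally show ?thesis
    unfolding B_def ev_def by (metis Ints_of_int of_int_hom.coeff_map_poly_hom)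
qed

section \<open>Prime ideals of cyclotomic rings\<close>

definition cyclo_ring :: "nat \<Rightarrow> complex set" where
  "cyclo_ring n = range (\<lambda>f::int poly. poly (of_int_poly f) (zeta n))"

lemma cyclo_ring_of_int [intro, simp]: "of_int m \<in> cyclo_ring n"
  unfolding cyclo_ring_def by (rule range_eqI[of _ _ "[:m:]"]) (simp add: of_int_hom.map_poly_pCons_hom)

lemma cyclo_ring_add: "a \<in> cyclo_ring n \<Longrightarrow> b \<in> cyclo_ring n \<Longrightarrow> a + b \<in> cyclo_ring n"
  unfolding cyclo_ring_def by (auto simp flip: poly_add of_int_poly_hom.hom_add)

lemma cyclo_ring_diff: "a \<in> cyclo_ring n \<Longrightarrow> b \<in> cyclo_ring n \<Longrightarrow> a - b \<in> cyclo_ring n"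
  unfolding cyclo_ring_def by (auto simp flip: poly_diff of_int_poly_hom.hom_minus)

lemma cyclo_ring_mult: "a \<in> cyclo_ring n \<Longrightarrow> b \<in> cyclo_ring n \<Longrightarrow> a * b \<in> cyclo_ring n"
  unfolding cyclo_ring_def by (auto simp flip: poly_mult of_int_poly_hom.hom_mult)

lemma cyclo_ring_1 [intro, simp]: "1 \<in> cyclo_ring n"
  using cyclo_ring_of_int[of 1] by simp

lemma cyclo_ring_0 [intro, simp]: "0 \<in> cyclo_ring n"
  using cyclo_ring_of_int[of 0] by simp

lemma cyclo_ring_power: "a \<in> cyclo_ring n \<Longrightarrow> a ^ k \<in> cyclo_ring n"
  by (induction k) (auto intro: cyclo_ring_mult)

lemma cyclo_ring_prod: "(\<And>x. x \<in> A \<Longrightarrow> g x \<in> cyclo_ring n) \<Longrightarrow> prod g A \<in> cyclo_ring n"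
  by (induction A rule: infinite_finite_induct) (auto intro: cyclo_ring_mult)

lemma zeta_in_cyclo_ring: "zeta n \<in> cyclo_ring n"
  unfolding cyclo_ring_def by (rule range_eqI[of _ _ "[:0, 1:]"]) simp

lemma root_of_unity_in_cyclo_ring:
  assumes "n > 0" "m dvd n" "z ^ m = 1"
  shows "z \<in> cyclo_ring n"
proof -
  obtain q where "n = m * q" using assms by auto
  hence "z ^ n = 1" using assms by (simp add: power_mult)
  then obtain j where "z = zeta n ^ j"
    using root_of_unity_eq_zeta_power assms(1) by metis
  thus ?thesis by (simp add: cyclo_ring_power zeta_in_cyclo_ring)
qed

lemma poly_in_cyclo_ring:
  fixes f :: "int poly"
  assumes "z \<in> cyclo_ring n"
  shows "poly (of_int_poly f) z \<in> cyclo_ring n"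
  by (induction f) (auto intro!: cyclo_ring_add cyclo_ring_mult assms simp: of_int_poly_hom.map_poly_pCons_hom)

lemma cyclo_ring_algebraic_int:
  assumes "n > 0" "a \<in> cyclo_ring n"
  shows "algebraic_int a"
proof -
  obtain f :: "int poly" where f: "a = poly (of_int_poly f) (zeta n)"
    using assms(2) by (auto simp: cyclo_ring_def)
  obtain g :: "int poly" where g: "of_int_poly g =
    (\<Prod>a<n. [: - poly (of_int_poly f) (zeta n ^ a), 1 :])"
    using char_poly_circulant[OF assms(1)] by blast
  \<comment> \<open>\<open>1 mod n\<close> is an index of \<open>zeta n\<close> itself, also when
    \<open>n = 1\<close>.\<close>
  have "1 mod n < n" using assms(1) by simp
  moreover have "zeta n ^ (1 mod n) = zeta n"
    using zeta_power_mod[OF assms(1), of 1] by simp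
  ultimately have "poly (of_int_poly g) a = 0"
    unfolding g f by (auto simp: poly_prod intro!: bexI[of _ "1 mod n"])
  moreover have "lead_coeff (of_int_poly g :: complex poly) = 1"
    unfolding g by (simp add: lead_coeff_prod)
  hence "lead_coeff g = 1"
    by simp
  ultimately show ?thesis
    by (auto simp: algebraic_int_altdef_ipoly)
qed

text \<open>Otherwise 1/p would be a rational algebraic integer, hence an integer. This makes the
  ideal generated by \<open>p\<close> proper.\<close>

lemma inverse_prime_notin_cyclo_ring:
  assumes "n > 0" "prime (p::nat)" "a \<in> cyclo_ring n"
  shows "of_nat p * a \<noteq> 1"
proof
  assume *: "of_nat p * a = 1"
  have "p \<noteq> 0" using assms by auto
  hence a: "a = of_rat (1 / of_nat p)"
    using * by (simp add: field_simps of_rat_divide)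
  hence "a \<in> \<int>"
    using cyclo_ring_algebraic_int[OF assms(1,3)] by (intro rational_algebraic_int_is_int) auto
  then obtain m where "a = of_int m" by (auto elim: Ints_cases)
  with * have "of_int (int p * m) = (1::complex)" by simp
  hence "int p * m = 1" by (simp only: of_int_eq_1_iff)
  hence "int p dvd 1" by (metis dvd_triv_left)
  thus False using assms(2) by auto
qed

section \<open>Existence of a prime ideal above p\<close>

definition ideal_of :: "complex set \<Rightarrow> complex set \<Rightarrow> bool" where
  "ideal_of R I \<longleftrightarrow> I \<subseteq> R \<and> 0 \<in> I \<and> (\<forall>a\<in>I. \<forall>b\<in>I. a + b \<in> I) \<and> (\<forall>r\<in>R. \<forall>a\<in>I. r * a \<in> I)"

text \<open>Congruence modulo \<open>Q\<close> plays the role of a reduction map from the cyclotomic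
  ring to characteristic \<open>p\<close>, so that no quotient ring has to be formed.\<close>

locale prime_over =
  fixes n p :: nat and Q :: "complex set"
  assumes n_pos: "n > 0" and prime_p: "prime p"
    and ideal: "ideal_of (cyclo_ring n) Q"
    and p_in: "of_nat p \<in> Q" and one_notin: "1 \<notin> Q"
    and prime_ideal: "\<And>a b. a \<in> cyclo_ring n \<Longrightarrow> b \<in> cyclo_ring n \<Longrightarrow> a * b \<in> Q \<Longrightarrow> a \<in> Q \<or> b \<in> Q"

text \<open>Zorn's lemma gives an ideal that is maximal among those containing \<open>p\<close> but
  not 1, and such an ideal is prime.\<close>

lemma prime_over_exists:
  assumes n: "n > 0" and p: "prime p"
  shows "\<exists>Q. prime_over n p Q"
proof -
  let ?R = "cyclo_ring n"
  define \<A> where "\<A> = {I. ideal_of ?R I \<and> of_nat p \<in> I \<and> 1 \<notin> I}"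
  define I0 where "I0 = (\<lambda>a. of_nat p * a) ` ?R"
  have "ideal_of ?R I0"
    unfolding ideal_of_def
  proof (intro conjI ballI)
    show "I0 \<subseteq> ?R"
      unfolding I0_def using cyclo_ring_of_int[of "int p" n] by (auto intro!: cyclo_ring_mult)
    show "0 \<in> I0" unfolding I0_def by (rule image_eqI[of _ _ 0]) auto
    fix a b assume "a \<in> I0" "b \<in> I0"
    thus "a + b \<in> I0"
      unfolding I0_def by (auto simp: distrib_left[symmetric] intro: cyclo_ring_add)
  next
    fix r a assume "r \<in> ?R" "a \<in> I0"
    thus "r * a \<in> I0"
      unfolding I0_def by (auto simp: mult.left_commute[of r] intro: cyclo_ring_mult)
  qed
  moreover have "of_nat p \<in> I0" unfolding I0_def by (rule image_eqI[of _ _ 1]) auto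
  moreover have "1 \<notin> I0" using inverse_prime_notin_cyclo_ring[OF n p] unfolding I0_def by force
  ultimately have "I0 \<in> \<A>" by (simp add: \<A>_def)
  hence "\<A> \<noteq> {}" by blast
  moreover have "\<Union>\<C> \<in> \<A>" if ne: "\<C> \<noteq> {}" and ch: "subset.chain \<A> \<C>" for \<C>
  proof -
    have sub: "\<And>I. I \<in> \<C> \<Longrightarrow> I \<in> \<A>" and cmp: "\<And>I J. I \<in> \<C> \<Longrightarrow> J \<in> \<C> \<Longrightarrow> I \<subseteq> J \<or> J \<subseteq> I"
      using ch by (auto simp: subset_chain_def)
    have id: "ideal_of ?R I" if "I \<in> \<C>" for I using sub[OF that] by (simp add: \<A>_def)
    have "ideal_of ?R (\<Union>\<C>)"
      unfolding ideal_of_def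
    proof (intro conjI ballI)
      show "\<Union>\<C> \<subseteq> ?R" using id unfolding ideal_of_def by blast
      show "0 \<in> \<Union>\<C>" using id ne unfolding ideal_of_def by blast
      fix a b assume "a \<in> \<Union>\<C>" "b \<in> \<Union>\<C>"
      then obtain I J where IJ: "I \<in> \<C>" "J \<in> \<C>" "a \<in> I" "b \<in> J" by blast
      then obtain K where "K \<in> \<C>" "a \<in> K" "b \<in> K" using cmp[of I J] by blast
      thus "a + b \<in> \<Union>\<C>" using id unfolding ideal_of_def by blast
    next
      fix r a assume "r \<in> ?R" "a \<in> \<Union>\<C>"
      thus "r * a \<in> \<Union>\<C>" using id unfolding ideal_of_def by blast
    qed
    thus ?thesis using sub ne unfolding \<A>_def by blast
  qed
  ultimately obtain Q where Q: "Q \<in> \<A>" and max: "\<And>I. I \<in> \<A> \<Longrightarrow> Q \<subseteq> I \<Longrightarrow> I = Q"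
    using subset_Zorn_nonempty[of \<A>] by blast
  have idQ: "ideal_of ?R Q" and pQ: "of_nat p \<in> Q" and oneQ: "1 \<notin> Q"
    using Q by (auto simp: \<A>_def)
  have "a \<in> Q \<or> b \<in> Q" if a: "a \<in> ?R" and b: "b \<in> ?R" and ab: "a * b \<in> Q" for a b
  proof (rule ccontr)
    assume neg: "\<not> (a \<in> Q \<or> b \<in> Q)"
    \<comment> \<open>\<open>I\<close> is the ideal generated by \<open>Q\<close> and
      \<open>a\<close>. Maximality puts 1 into it, and multiplying 1 = q + a r by \<open>b\<close>
      puts \<open>b\<close> into \<open>Q\<close>.\<close>
    define I where "I = {q + a * r | q r. q \<in> Q \<and> r \<in> ?R}"
    have "ideal_of ?R I"
      unfolding ideal_of_def
    proof (intro conjI ballI)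
      show "I \<subseteq> ?R"
        using idQ a unfolding I_def ideal_of_def by (auto intro!: cyclo_ring_add cyclo_ring_mult)
      have "0 = 0 + a * 0" by simp
      thus "0 \<in> I" using idQ unfolding I_def ideal_of_def by blast
      fix x y assume "x \<in> I" "y \<in> I"
      then obtain q r q' r' where h: "x = q + a * r" "y = q' + a * r'" "q \<in> Q" "q' \<in> Q" "r \<in> ?R" "r' \<in> ?R"
        unfolding I_def by blast
      have "x + y = (q + q') + a * (r + r')" using h by (simp add: algebra_simps)
      moreover have "q + q' \<in> Q" "r + r' \<in> ?R" using h idQ by (auto simp: ideal_of_def intro: cyclo_ring_add)
      ultimately show "x + y \<in> I" unfolding I_def by blast
    next
      fix s x assume s: "s \<in> ?R" and "x \<in> I"
      then obtain q r where h: "x = q + a * r" "q \<in> Q" "r \<in> ?R" unfolding I_def by blast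
      have "s * x = s * q + a * (s * r)" using h by (simp add: algebra_simps)
      moreover have "s * q \<in> Q" "s * r \<in> ?R" using h s idQ by (auto simp: ideal_of_def intro: cyclo_ring_mult)
      ultimately show "s * x \<in> I" unfolding I_def by blast
    qed
    moreover have QI: "Q \<subseteq> I"
    proof
      fix q assume "q \<in> Q"
      moreover have "q = q + a * 0" by simp
      ultimately show "q \<in> I" unfolding I_def using cyclo_ring_0 by blast
    qed
    moreover have "a \<in> I"
    proof -
      have "a = 0 + a * 1" by simp
      thus ?thesis using idQ cyclo_ring_1 unfolding I_def ideal_of_def by blast
    qed
    ultimately have "1 \<in> I" using max[of I] pQ neg unfolding \<A>_def by blast
    then obtain q r where h: "1 = q + a * r" "q \<in> Q" "r \<in> ?R" unfolding I_def by blast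
    have "b = b * (q + a * r)" using h by simp
    also have "\<dots> = b * q + r * (a * b)" by (simp add: algebra_simps)
    also have "\<dots> \<in> Q" using idQ h b ab unfolding ideal_of_def by blast
    finally show False using neg by blast
  qed
  hence "prime_over n p Q"
    by unfold_locales (use n p idQ pQ oneQ in auto)
  thus ?thesis by blast
qed

section \<open>Norm estimates modulo the prime ideal\<close>

context prime_over
begin

lemma Q_add: "a \<in> Q \<Longrightarrow> b \<in> Q \<Longrightarrow> a + b \<in> Q"
  using ideal by (auto simp: ideal_of_def)

lemma Q_mult: "r \<in> cyclo_ring n \<Longrightarrow> a \<in> Q \<Longrightarrow> r * a \<in> Q"
  using ideal by (auto simp: ideal_of_def)

lemma Q_0: "0 \<in> Q"
  using ideal by (auto simp: ideal_of_def)

lemma Q_diff: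
  assumes "a \<in> Q" "b \<in> Q"
  shows "a - b \<in> Q"
  using Q_add[OF assms(1) Q_mult[OF cyclo_ring_of_int[of "-1"] assms(2)]] by simp

lemma of_int_in_Q_iff: "of_int m \<in> Q \<longleftrightarrow> int p dvd m"
proof
  assume "int p dvd m"
  then obtain k where "m = int p * k" by auto
  hence "of_int m = of_int k * (of_nat p :: complex)" by simp
  thus "of_int m \<in> Q" using Q_mult[OF cyclo_ring_of_int p_in] by simp
next
  assume m: "of_int m \<in> Q"
  show "int p dvd m"
  proof (rule ccontr)
    assume "\<not> int p dvd m"
    hence "coprime (int p) m" using prime_p by (simp add: prime_imp_coprime)
    then obtain u v where "u * int p + v * m = 1"
      using bezout_int[of "int p" m] by auto
    hence "of_int (u * int p + v * m) = (1 :: complex)" by simp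
    hence "of_int u * of_nat p + of_int v * of_int m = (1 :: complex)" by simp
    moreover have "of_int u * of_nat p + of_int v * of_int m \<in> Q"
      by (intro Q_add Q_mult p_in m cyclo_ring_of_int)
    ultimately show False using one_notin by simp
  qed
qed

lemma prod_in_Q:
  assumes "finite A" "\<And>x. x \<in> A \<Longrightarrow> g x \<in> cyclo_ring n" "prod g A \<in> Q"
  shows "\<exists>x\<in>A. g x \<in> Q"
  using assms
proof (induction A rule: finite_induct)
  case empty
  thus ?case using one_notin by simp
next
  case (insert x A)
  thus ?case using prime_ideal[of "g x" "prod g A"] cyclo_ring_prod[of A g n] by auto
qed

text \<open>The product of the nonzero conjugates is a nonzero integer, and it lies in
  \<open>Q\<close> because one factor does; so \<open>p\<close> divides it. Conjugates are counted
  over \<open>m\<close> and not over \<open>n\<close>, which keeps the exponent small while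
  \<open>n\<close> may be huge.\<close>

lemma prime_le_power_of_conjugate_bound:
  fixes f :: "int poly"
  assumes m: "m > 0" "m dvd n"
    and inQ: "poly (of_int_poly f) (zeta m) \<in> Q" and nz: "poly (of_int_poly f) (zeta m) \<noteq> 0"
    and bd: "\<And>z::complex. z ^ m = 1 \<Longrightarrow> norm (poly (of_int_poly f) z) \<le> B" and B: "B \<ge> 1"
  shows "real p \<le> B ^ m"
proof -
  define ev where "ev a = poly (of_int_poly f) (zeta m ^ a)" for a
  define A where "A = {a. a < m \<and> ev a \<noteq> 0}"
  have fin: "finite A" by (simp add: A_def)
  obtain N where N: "(\<Prod>a\<in>A. - ev a) = of_int N"
    using prod_nonzero_conjugates_int[OF m(1), of f] unfolding ev_def A_def by (auto elim: Ints_cases)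
  have z1: "(zeta m ^ a) ^ m = 1" for a by (rule zeta_power_power[OF m(1)])
  have ring: "ev a \<in> cyclo_ring n" for a
    unfolding ev_def using root_of_unity_in_cyclo_ring[OF n_pos m(2) z1] by (intro poly_in_cyclo_ring)
  have "zeta m ^ (1 mod m) = zeta m"
    using zeta_power_mod[OF m(1), of 1] by simp
  hence one: "1 mod m \<in> A" "ev (1 mod m) \<in> Q" using inQ nz m(1) by (auto simp: A_def ev_def)
  have "(\<Prod>a\<in>A. - ev a) = (\<Prod>a\<in>A - {1 mod m}. - ev a) * (- 1) * ev (1 mod m)"
    using prod.remove[OF fin one(1), of "\<lambda>a. - ev a"] by simp
  also have "\<dots> \<in> Q"
  proof (intro Q_mult cyclo_ring_mult cyclo_ring_prod one)
    show "-1 \<in> cyclo_ring n" using cyclo_ring_of_int[of "-1" n] by simp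
    fix a show "- ev a \<in> cyclo_ring n"
      using cyclo_ring_diff[OF cyclo_ring_0 ring[of a]] by simp
  qed
  finally have "int p dvd N" unfolding N of_int_in_Q_iff .
  moreover have "N \<noteq> 0"
  proof
    assume "N = 0"
    hence "(\<Prod>a\<in>A. - ev a) = 0" using N by simp
    thus False using fin by (auto simp: A_def)
  qed
  ultimately have "int p \<le> \<bar>N\<bar>" by (metis abs_of_nat dvd_imp_le_int)
  hence "real p \<le> norm (of_int N :: complex)" by simp
  also have "\<dots> = (\<Prod>a\<in>A. norm (- ev a))" by (simp only: N[symmetric] prod_norm)
  also have "\<dots> = (\<Prod>a\<in>A. norm (ev a))" by simp
  also have "\<dots> \<le> (\<Prod>a\<in>A. B)"
    by (intro prod_mono conjI norm_ge_zero) (unfold ev_def, rule bd[OF z1])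
  also have "\<dots> = B ^ card A" by simp
  also have "\<dots> \<le> B ^ m"
  proof (intro power_increasing B)
    have "A \<subseteq> {..<m}" by (auto simp: A_def)
    from card_mono[OF _ this] show "card A \<le> m" by simp
  qed
  finally show ?thesis .
qed

end

section \<open>Second-order linear recurrences\<close>

text \<open>With X = u + 1/u, the starting values 2, X give D_k = u^k + u^(-k), and 0, 1 give U_k =
  (u^k - u^(-k)) / (u - 1/u); these are Chebyshev polynomials up to scaling. The rotation over
  \<open>x\<close> follows this recurrence with X = 3x.\<close>

fun lrec :: "'a::comm_ring_1 \<Rightarrow> 'a \<Rightarrow> 'a \<Rightarrow> nat \<Rightarrow> 'a" where
  "lrec X a b 0 = a"
| "lrec X a b (Suc 0) = b"
| "lrec X a b (Suc (Suc n)) = X * lrec X a b (Suc n) - lrec X a b n"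

lemma of_int_lrec: "of_int (lrec X a b k) = lrec (of_int X) (of_int a) (of_int b) k"
  by (induction X a b k rule: lrec.induct) auto

lemma lrec_scale: "lrec X (c * a) (c * b) k = c * lrec X a b k"
  by (induction X a b k rule: lrec.induct) (auto simp: algebra_simps)

lemma lrec_cong:
  fixes X :: int
  assumes "[X = X'] (mod m)" "[a = a'] (mod m)" "[b = b'] (mod m)"
  shows "[lrec X a b k = lrec X' a' b' k] (mod m)"
  by (induction k rule: induct_nat_012) (auto intro!: cong_diff cong_mult assms)

lemma lrec_add_recip:
  fixes u :: "'a::comm_ring_1"
  assumes "u * v = 1"
  shows "lrec (u + v) 2 (u + v) k = u ^ k + v ^ k"
proof (induction k rule: nat_less_induct)
  case (1 k)
  consider "k = 0" | "k = 1" | j where "k = Suc (Suc j)"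
    by (metis One_nat_def not0_implies_Suc)
  thus ?case
  proof cases
    case 3
    have uv: "u * (v * z) = z" for z
      using assms by (simp flip: mult.assoc)
    have "lrec (u + v) 2 (u + v) k = (u + v) * (u ^ Suc j + v ^ Suc j) - (u ^ j + v ^ j)"
      using 1 3 by simp
    also have "\<dots> = u ^ k + v ^ k"
      by (simp add: 3 algebra_simps uv)
    finally show ?thesis .
  qed auto
qed

lemma lrec_expand:
  "lrec X a b (Suc k) = lrec X 0 1 (Suc k) * b - lrec X 0 1 k * a"
proof (induction k rule: induct_nat_012)
  case (ge2 k)
  let ?U = "lrec X 0 1"
  have "lrec X a b (Suc (Suc (Suc k))) =
      X * (?U (Suc (Suc k)) * b - ?U (Suc k) * a) - (?U (Suc k) * b - ?U k * a)"
    by (simp only: lrec.simps(3)[of X a b "Suc k"] ge2)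
  thus ?case by (simp add: algebra_simps)
qed (auto simp: algebra_simps)

text \<open>The form s^2 + t^2 - X s t is preserved by each step of the recurrence and equals 1 at
  the start.\<close>

lemma lrec_0_1_det:
  "lrec X 0 1 (Suc k) ^ 2 + lrec X 0 1 k ^ 2 - X * lrec X 0 1 (Suc k) * lrec X 0 1 k = 1"
  by (induction k) (auto simp: algebra_simps power2_eq_square)

lemma lrec_2_X_Suc:
  "lrec X 2 X (Suc k) = X * lrec X 0 1 (Suc k) - 2 * lrec X 0 1 k"
  by (subst lrec_expand) (simp add: algebra_simps)

text \<open>In terms of u both sides are (u^k - u^(-k))^2. The proof stays polynomial, so it is
  valid in every commutative ring.\<close>

lemma lrec_2_X_square: "lrec X 2 X k ^ 2 - 4 = (X ^ 2 - 4) * lrec X 0 1 k ^ 2"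
proof (cases k)
  case (Suc j)
  define u v where "u = lrec X 0 1 (Suc j)" and "v = lrec X 0 1 j"
  have det: "u ^ 2 + v ^ 2 - X * u * v = 1" unfolding u_def v_def by (rule lrec_0_1_det)
  \<comment> \<open>The factor 1 is kept visible so that \<open>det\<close> can replace it by a
    quadratic form.\<close>
  have "lrec X 2 X k ^ 2 - 4 = (X * u - 2 * v) ^ 2 - 4 * 1"
    unfolding Suc lrec_2_X_Suc u_def v_def by simp
  also have "\<dots> = (X * u - 2 * v) ^ 2 - 4 * (u ^ 2 + v ^ 2 - X * u * v)"
    by (simp only: det)
  also have "\<dots> = (X ^ 2 - 4) * u ^ 2" by (simp add: algebra_simps power2_eq_square)
  finally show ?thesis by (simp add: Suc u_def)
qed simp

text \<open>Terms \<open>k\<close> apart obey the recurrence with trace D_k, so their form with D_k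
  in place of X is a multiple of the form of two neighbours. This eliminates all terms in
  between.\<close>

lemma lrec_form:
  "a ^ 2 + lrec X a b k ^ 2 - lrec X 2 X k * a * lrec X a b k =
     lrec X 0 1 k ^ 2 * (a ^ 2 + b ^ 2 - X * a * b)"
proof (cases k)
  case (Suc j)
  define u v where "u = lrec X 0 1 (Suc j)" and "v = lrec X 0 1 j"
  have det: "u ^ 2 + v ^ 2 - X * u * v = 1" unfolding u_def v_def by (rule lrec_0_1_det)
  have "a ^ 2 + lrec X a b k ^ 2 - lrec X 2 X k * a * lrec X a b k =
     1 * a ^ 2 + (u * b - v * a) ^ 2 - (X * u - 2 * v) * a * (u * b - v * a)"
    unfolding Suc lrec_2_X_Suc lrec_expand[of X a b] u_def v_def by simp
  also have "\<dots> = (u ^ 2 + v ^ 2 - X * u * v) * a ^ 2 + (u * b - v * a) ^ 2 - (X * u - 2 * v) * a * (u * b - v * a)"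
    by (simp only: det)
  also have "\<dots> = u ^ 2 * (a ^ 2 + b ^ 2 - X * a * b)" by (simp add: algebra_simps power2_eq_square)
  finally show ?thesis by (simp add: Suc u_def)
qed (simp add: power2_eq_square)

text \<open>Multiplying by X^2 - 4 trades U_k^2 for D_k^2 - 4. The last factor on the right is the
  Markoff polynomial in X, a, b, so the left side vanishes modulo \<open>p\<close> along a rotation
  orbit.\<close>

lemma lrec_form_multiple:
  "(X ^ 2 - 4) * (a ^ 2 + lrec X a b k ^ 2 - lrec X 2 X k * a * lrec X a b k) + X ^ 2 * (lrec X 2 X k ^ 2 - 4)
   = (lrec X 2 X k ^ 2 - 4) * (X ^ 2 + a ^ 2 + b ^ 2 - X * a * b)"
  unfolding lrec_form lrec_2_X_square by (simp add: algebra_simps)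

text \<open>This is Cayley-Hamilton for the \<open>k\<close>-th power of the step matrix, which has
  determinant 1 and trace D_k.\<close>

lemma lrec_add_diff: "lrec X a b (m + k + k) + lrec X a b m = lrec X 2 X k * lrec X a b (m + k)"
proof (induction k arbitrary: m rule: induct_nat_012)
  case (ge2 k)
  let ?Y = "lrec X a b"
  let ?D = "lrec X 2 X"
  have 1: "?Y (Suc (Suc (Suc (m + k + k)))) + ?Y (Suc m) = ?D (Suc k) * ?Y (Suc (Suc (m + k)))"
    using ge2(2)[of "Suc m"] by (simp del: lrec.simps)
  have 2: "?Y (Suc (Suc (m + k + k))) + ?Y (Suc (Suc m)) = ?D k * ?Y (Suc (Suc (m + k)))"
    using ge2(1)[of "Suc (Suc m)"] by (simp del: lrec.simps)
  have "?Y (Suc (Suc (Suc (Suc (m + k + k))))) + ?Y m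
     = X * (?Y (Suc (Suc (Suc (m + k + k)))) + ?Y (Suc m)) - (?Y (Suc (Suc (m + k + k))) + ?Y (Suc (Suc m)))"
    by (simp only: lrec.simps(3)[of X a b "Suc (Suc (m + k + k))"] lrec.simps(3)[of X a b m]) (simp add: algebra_simps del: lrec.simps)
  also have "\<dots> = ?D (Suc (Suc k)) * ?Y (Suc (Suc (m + k)))"
    unfolding 1 2 by (simp only: lrec.simps(3)[of X 2 X k]) (simp add: algebra_simps del: lrec.simps)
  finally show ?case by (simp del: lrec.simps)
qed (auto simp: algebra_simps)

lemma lrec_neg2: "lrec (-2) 0 1 k = (-1) ^ Suc k * (of_nat k :: 'a :: comm_ring_1)"
  by (induction k rule: induct_nat_012) (auto simp: algebra_simps)

lemma lrec_pos2: "lrec 2 0 1 k = (of_nat k :: 'a :: comm_ring_1)"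
  by (induction k rule: induct_nat_012) (auto simp: algebra_simps)

section \<open>Factoring D_n - 2 over the roots of unity\<close>

lemma power_diff_1_eq_prod_zeta:
  assumes n: "n > 0"
  shows "(\<Prod>j<n. u - zeta n ^ j) = u ^ n - 1"
proof -
  have z1: "(zeta n ^ j) ^ n = 1" for j by (rule zeta_power_power[OF n])
  have inj: "inj_on (\<lambda>j. zeta n ^ j) {..<n}"
    using bij_betw_roots_unity[OF n] by (simp add: bij_betw_def zeta_def DeMoivre mult_ac)
  let ?p = "\<Prod>j<n. [:- (zeta n ^ j), 1:]" and ?q = "Polynomial.monom 1 n - 1 :: complex poly"
  have "degree ?p = (\<Sum>j<n. degree [:- (zeta n ^ j), 1:])"
    by (rule degree_prod_eq_sum_degree) auto
  hence dp: "degree ?p = n" by simp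
  have dq: "degree ?q \<le> n"
    by (intro degree_diff_le) (auto simp: degree_monom_le)
  have "?p = ?q"
  proof (rule poly_eqI_degree_lead_coeff[where n = n and A = "(\<lambda>j. zeta n ^ j) ` {..<n}"])
    have "lead_coeff ?p = 1" by (simp add: lead_coeff_prod)
    thus "Polynomial.coeff ?p n = Polynomial.coeff ?q n" using dp n by simp
    show "n \<le> card ((\<lambda>j. zeta n ^ j) ` {..<n})" using card_image[OF inj] by simp
    fix z assume "z \<in> (\<lambda>j. zeta n ^ j) ` {..<n}"
    then obtain j where j: "j < n" "z = zeta n ^ j" by auto
    have "poly ?q z = z ^ n - 1" by (simp add: poly_monom)
    also have "\<dots> = 0" using z1[of j] j(2) by simp
    finally have "poly ?q z = 0" .
    moreover have "poly ?p z = 0" using j by (auto simp: poly_prod)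
    ultimately show "poly ?p z = poly ?q z" by simp
  qed (use dp dq in auto)
  from arg_cong[OF this, of "\<lambda>p. poly p u"] show ?thesis
    by (simp add: poly_prod poly_monom)
qed

lemma unit_mult_cnj: "norm z = 1 \<Longrightarrow> z * cnj z = 1"
  by (simp add: complex_norm_square[symmetric])

lemma norm_root_of_unity: "n > 0 \<Longrightarrow> z ^ n = 1 \<Longrightarrow> norm (z::complex) = 1"
  by (metis norm_one norm_power power_eq_1_iff norm_ge_zero  power_eq_iff_eq_base power_one zero_le_one)

lemma cnj_root_of_unity: "n > 0 \<Longrightarrow> z ^ n = 1 \<Longrightarrow> z * cnj z = 1"
  by (simp add: complex_norm_square[symmetric] norm_root_of_unity)

text \<open>For X = u + 1/u the left side is -(u^n - 1)(u^(-n) - 1). Both factors split over the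
  \<open>n\<close>-th roots of unity, and the two linear factors of a root w combine, up to a unit,
  to X - (w + 1/w).\<close>

lemma lrec_2_X_minus_2_factor:
  fixes X :: complex
  assumes n: "n > 0"
  shows "lrec X 2 X n - 2 = (\<Prod>j<n. X - (zeta n ^ j + cnj (zeta n ^ j)))"
proof -
  obtain u where u: "u ^ 2 - X * u + 1 = 0"
  proof
    show "((X + csqrt (X ^ 2 - 4)) / 2) ^ 2 - X * ((X + csqrt (X ^ 2 - 4)) / 2) + 1 = 0"
      by (simp add: field_simps power2_sum flip: power2_eq_square)
  qed
  have u0: "u \<noteq> 0" using u by auto
  define v where "v = 1 / u"
  have uv: "u * v = 1" and X: "X = u + v"
    using u u0 by (auto simp: v_def field_simps power2_eq_square)
  have z: "norm (zeta n ^ j) = 1" for j by (simp add: zeta_def norm_power)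
  have "X - (zeta n ^ j + cnj (zeta n ^ j)) = (u - zeta n ^ j) * (v - zeta n ^ j) * (0 - cnj (zeta n ^ j))" for j
  proof -
    define w where "w = zeta n ^ j"
    have w: "w * cnj w = 1" unfolding w_def by (rule unit_mult_cnj[OF z])
    have "(u - w) * (v - w) * (- cnj w) = - (u * v) * cnj w + (u + v) * (w * cnj w) - w * (w * cnj w)"
      by (simp add: algebra_simps)
    thus ?thesis using uv w by (simp add: X w_def)
  qed
  hence "(\<Prod>j<n. X - (zeta n ^ j + cnj (zeta n ^ j))) =
     (\<Prod>j<n. u - zeta n ^ j) * (\<Prod>j<n. v - zeta n ^ j) * (\<Prod>j<n. 0 - cnj (zeta n ^ j))"
    by (simp only: prod.distrib)
  also have "(\<Prod>j<n. 0 - cnj (zeta n ^ j)) = cnj (\<Prod>j<n. 0 - zeta n ^ j)"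
    by (simp add: cnj_prod)
  \<comment> \<open>The product is the value of u^n - 1 at u = 0.\<close>
  also have "\<dots> = - 1" using n by (simp only: power_diff_1_eq_prod_zeta[OF n]) simp
  also have "(\<Prod>j<n. u - zeta n ^ j) * (\<Prod>j<n. v - zeta n ^ j) * - 1 = (u ^ n - 1) * (v ^ n - 1) * - 1"
    by (simp only: power_diff_1_eq_prod_zeta[OF n])
  also have "\<dots> = u ^ n + v ^ n - 1 - (u * v) ^ n"
    by (simp add: algebra_simps power_mult_distrib)
  also have "\<dots> = lrec X 2 X n - 2"
    unfolding X lrec_add_recip[OF uv] by (simp add: uv)
  finally show ?thesis ..
qed

section \<open>Lifting to characteristic zero\<close>

context prime_over
begin

text \<open>Membership of both sides in the ring is part of the relation, so that congruences can be
  multiplied without side conditions.\<close>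

definition cong_Q :: "complex \<Rightarrow> complex \<Rightarrow> bool" where
  "cong_Q a b \<longleftrightarrow> a \<in> cyclo_ring n \<and> b \<in> cyclo_ring n \<and> a - b \<in> Q"

lemma cong_Q_of_int [intro]: "cong_Q (of_int m) (of_int m)"
  by (simp add: cong_Q_def Q_0)

lemma cong_Q_add: "cong_Q a b \<Longrightarrow> cong_Q c d \<Longrightarrow> cong_Q (a + c) (b + d)"
  using Q_add[of "a - b" "c - d"] by (auto simp: cong_Q_def algebra_simps intro: cyclo_ring_add)

lemma cong_Q_diff: "cong_Q a b \<Longrightarrow> cong_Q c d \<Longrightarrow> cong_Q (a - c) (b - d)"
  using Q_diff[of "a - b" "c - d"] by (auto simp: cong_Q_def algebra_simps intro: cyclo_ring_diff)

lemma cong_Q_mult: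
  assumes "cong_Q a b" "cong_Q c d"
  shows "cong_Q (a * c) (b * d)"
proof -
  have "a * c - b * d = c * (a - b) + b * (c - d)" by (simp add: algebra_simps)
  also have "\<dots> \<in> Q" using assms by (intro Q_add Q_mult) (auto simp: cong_Q_def)
  finally show ?thesis using assms by (auto simp: cong_Q_def intro: cyclo_ring_mult)
qed

lemma cong_Q_power: "cong_Q a b \<Longrightarrow> cong_Q (a ^ k) (b ^ k)"
  using cong_Q_of_int[of 1] by (induction k) (auto intro: cong_Q_mult)

lemma cong_Q_lrec: "cong_Q X X' \<Longrightarrow> cong_Q a a' \<Longrightarrow> cong_Q b b' \<Longrightarrow> cong_Q (lrec X a b k) (lrec X' a' b' k)"
  by (induction k rule: induct_nat_012) (auto intro: cong_Q_diff cong_Q_mult)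

text \<open>The divisibility says that the product of X - (w + 1/w) over w^m = 1 lies in
  \<open>Q\<close>; being prime, \<open>Q\<close> contains one of the factors. This provides the
  lift to characteristic 0.\<close>

lemma ex_root_of_unity_cong_Q:
  assumes "m > 0" "m dvd n" "int p dvd lrec X 2 X m - 2"
  shows "\<exists>\<xi>. \<xi> ^ m = 1 \<and> cong_Q (of_int X) (\<xi> + cnj \<xi>)"
proof -
  have z1: "(zeta m ^ j) ^ m = 1" for j by (rule zeta_power_power[OF assms(1)])
  have ring: "zeta m ^ j + cnj (zeta m ^ j) \<in> cyclo_ring n" for j
  proof (intro cyclo_ring_add)
    show "zeta m ^ j \<in> cyclo_ring n"
      by (rule root_of_unity_in_cyclo_ring[OF n_pos assms(2) z1])
    have "cnj (zeta m ^ j) ^ m = cnj ((zeta m ^ j) ^ m)" by (simp only: complex_cnj_power)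
    also have "\<dots> = 1" by (simp only: z1 complex_cnj_one)
    finally show "cnj (zeta m ^ j) \<in> cyclo_ring n"
      by (rule root_of_unity_in_cyclo_ring[OF n_pos assms(2)])
  qed
  have "of_int (lrec X 2 X m - 2) \<in> Q" using assms(3) by (simp only: of_int_in_Q_iff)
  moreover have "of_int (lrec X 2 X m - 2) = lrec (of_int X) 2 (of_int X) m - (2::complex)"
    by (simp add: of_int_lrec)
  ultimately have "(\<Prod>j<m. of_int X - (zeta m ^ j + cnj (zeta m ^ j))) \<in> Q"
    by (simp only: lrec_2_X_minus_2_factor[OF assms(1)])
  hence "\<exists>j\<in>{..<m}. of_int X - (zeta m ^ j + cnj (zeta m ^ j)) \<in> Q"
    by (rule prod_in_Q[OF finite_lessThan cyclo_ring_diff[OF cyclo_ring_of_int ring]])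
  then obtain j where j: "of_int X - (zeta m ^ j + cnj (zeta m ^ j)) \<in> Q" by blast
  thus ?thesis using ring[of j] z1[of j] by (intro exI[of _ "zeta m ^ j"]) (auto simp: cong_Q_def)
qed

end

text \<open>
  The relation between two terms at distance \<open>k\<close> of a rotation orbit: here \<open>d = \<xi>\<^sup>k + 1/\<xi>\<^sup>k\<close> when
  \<open>x = \<xi> + 1/\<xi>\<close>, and the factor \<open>x\<^sup>2 - 4 = (\<xi> - 1/\<xi>)\<^sup>2\<close> clears the denominator of
  \<open>(\<xi>\<^sup>k - 1/\<xi>\<^sup>k) / (\<xi> - 1/\<xi>)\<close>, whose conjugates would otherwise grow with \<open>k\<close>.
\<close>

definition lift_form :: "'a::comm_ring_1 \<Rightarrow> 'a \<Rightarrow> 'a \<Rightarrow> 'a \<Rightarrow> 'a" where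
  "lift_form x a b d = (x ^ 2 - 4) * (a ^ 2 + b ^ 2 - d * a * b) + x ^ 2 * (d ^ 2 - 4)"

text \<open>For |d| < 2 the quadratic form in \<open>a\<close> and \<open>b\<close> is nonnegative
  while \<open>x ^ 2 - 4\<close> is not positive, and the second summand is strictly negative. So
  the lifted relation cannot vanish in characteristic 0.\<close>

lemma lift_form_neg:
  fixes x a b d :: real
  assumes "\<bar>x\<bar> \<le> 2" "\<bar>d\<bar> < 2" "x \<noteq> 0"
  shows "lift_form x a b d < 0"
proof -
  have "x ^ 2 \<le> 2 ^ 2" using assms(1) by (metis abs_le_square_iff abs_numeral)
  hence 1: "x ^ 2 - 4 \<le> 0" by simp
  have "d ^ 2 < 2 ^ 2" using power_strict_mono[OF assms(2), of 2] by simp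
  hence 2: "d ^ 2 - 4 < 0" by simp
  have "a ^ 2 + b ^ 2 - d * a * b = (a - d * b / 2) ^ 2 + b ^ 2 * (4 - d ^ 2) / 4"
    by (simp add: power2_eq_square field_simps)
  also have "\<dots> \<ge> 0" using 2 by (intro add_nonneg_nonneg) auto
  finally have "(x ^ 2 - 4) * (a ^ 2 + b ^ 2 - d * a * b) \<le> 0"
    using 1 by (simp add: mult_nonpos_nonneg)
  moreover have "x ^ 2 * (d ^ 2 - 4) < 0" using 2 assms(3) by (simp add: mult_pos_neg)
  ultimately show ?thesis unfolding lift_form_def by linarith
qed

text \<open>The constant is 8 * 16 + 4 * 8, one product for each summand.\<close>

lemma norm_lift_form_le:
  fixes x a b d :: complex
  assumes "norm x \<le> 2" "norm a \<le> 2" "norm b \<le> 2" "norm d \<le> 2"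
  shows "norm (lift_form x a b d) \<le> 160"
proof -
  have sq: "norm (y ^ 2) \<le> 4" if "norm y \<le> 2" for y :: complex
    using power_mono[OF that norm_ge_zero, of 2] by (simp add: norm_power)
  have sq4: "norm (y ^ 2 - 4) \<le> 8" if "norm y \<le> 2" for y :: complex
    using norm_triangle_ineq4[of "y ^ 2" 4] sq[OF that] by simp
  have "norm (d * a * b) \<le> 2 * 2 * 2"
    unfolding norm_mult by (intro mult_mono assms) auto
  hence "norm (a ^ 2 + b ^ 2 - d * a * b) \<le> 16"
    using norm_triangle_ineq4[of "a ^ 2 + b ^ 2" "d * a * b"] norm_triangle_ineq[of "a ^ 2" "b ^ 2"]
      sq[OF assms(2)] sq[OF assms(3)] by linarith
  hence "norm ((x ^ 2 - 4) * (a ^ 2 + b ^ 2 - d * a * b)) \<le> 8 * 16"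
    unfolding norm_mult using sq4[OF assms(1)] by (intro mult_mono) auto
  moreover have "norm (x ^ 2 * (d ^ 2 - 4)) \<le> 4 * 8"
    unfolding norm_mult using sq4[OF assms(4)] sq[OF assms(1)] by (intro mult_mono) auto
  ultimately show ?thesis
    unfolding lift_form_def
    using norm_triangle_ineq[of "(x ^ 2 - 4) * (a ^ 2 + b ^ 2 - d * a * b)" "x ^ 2 * (d ^ 2 - 4)"]
    by linarith
qed

lemma lift_form_of_real:
  "lift_form (of_real x) (of_real a) (of_real b) (of_real d) = (of_real (lift_form x a b d) :: complex)"
  by (simp add: lift_form_def)

text \<open>The lift of the relation lies in \<open>Q\<close> and is nonzero by
  \<open>lift_form_neg\<close>, so the norm bound applies. The distance \<open>k\<close> enters only
  as an exponent of a root of unity, so the bound is independent of it.\<close>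

lemma (in prime_over) root_order_bound:
  fixes X a b :: int and \<xi> \<eta> \<theta> :: complex
  assumes m: "m > 0" "m dvd n"
    and roots: "\<xi> ^ m = 1" "\<eta> ^ m = 1" "\<theta> ^ m = 1"
    and cgs: "cong_Q (of_int X) (\<xi> + cnj \<xi>)" "cong_Q (of_int a) (\<eta> + cnj \<eta>)" "cong_Q (of_int b) (\<theta> + cnj \<theta>)"
    and dvd: "int p dvd lift_form X a b (lrec X 2 X k)"
    and nz: "\<xi> + cnj \<xi> \<noteq> 0" "\<xi> ^ (2 * k) \<noteq> 1"
  shows "real p \<le> 160 ^ m"
proof -
  obtain i where i: "i < m" "\<xi> = zeta m ^ i" by (rule root_of_unity_eq_zeta_power[OF m(1) roots(1)])
  obtain j where j: "j < m" "\<eta> = zeta m ^ j" by (rule root_of_unity_eq_zeta_power[OF m(1) roots(2)])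
  obtain l where l: "l < m" "\<theta> = zeta m ^ l" by (rule root_of_unity_eq_zeta_power[OF m(1) roots(3)])
  \<comment> \<open>The exponent \<open>(m - 1) * e\<close> represents \<open>-e\<close>, so
    \<open>t e\<close> takes the value z^e + z^(-e) at every \<open>m\<close>-th root of unity, and
    the conjugates of the lift are values of one polynomial.\<close>
  define t :: "nat \<Rightarrow> int poly" where
    "t e = Polynomial.monom 1 e + Polynomial.monom 1 ((m - 1) * e)" for e
  define f :: "int poly" where "f = lift_form (t i) (t j) (t l) (t (i * k))"
  define tr :: "complex \<Rightarrow> complex" where "tr z = z + cnj z" for z
  have f: "poly (of_int_poly f) z = lift_form (tr (z ^ i)) (tr (z ^ j)) (tr (z ^ l)) (tr (z ^ (i * k)))"
    if z: "z ^ m = 1" for z :: complex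
  proof -
    have "z * z ^ (m - 1) = 1" using z m(1) by (metis power_eq_if not_gr_zero)
    moreover have "z * cnj z = 1" using cnj_root_of_unity[OF m(1) z] .
    ultimately have "z ^ (m - 1) = cnj z"
      by (metis mult.assoc mult.commute mult.right_neutral)
    hence "poly (of_int_poly (t e)) z = tr (z ^ e)" for e
      by (simp add: t_def tr_def hom_distribs poly_monom power_mult)
    thus ?thesis by (simp add: f_def lift_form_def hom_distribs)
  qed
  have \<xi>k: "\<xi> ^ k = zeta m ^ (i * k)" by (simp add: i power_mult)
  have fz: "poly (of_int_poly f) (zeta m) = lift_form (tr \<xi>) (tr \<eta>) (tr \<theta>) (tr (\<xi> ^ k))"
    unfolding \<xi>k f[OF zeta_power[OF m(1)]] by (simp only: i(2) j(2) l(2))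
  have uxi: "\<xi> * cnj \<xi> = 1" by (rule cnj_root_of_unity[OF m(1) roots(1)])
  have "cong_Q (of_int (lrec X 2 X k)) (lrec (tr \<xi>) 2 (tr \<xi>) k)"
    unfolding of_int_lrec tr_def using cong_Q_of_int[of 2] by (intro cong_Q_lrec cgs) auto
  also have "lrec (tr \<xi>) 2 (tr \<xi>) k = tr (\<xi> ^ k)"
    unfolding tr_def lrec_add_recip[OF uxi] by simp
  finally have cgD: "cong_Q (of_int (lrec X 2 X k)) (tr (\<xi> ^ k))" .
  have "cong_Q (of_int (lift_form X a b (lrec X 2 X k))) (poly (of_int_poly f) (zeta m))"
    unfolding fz lift_form_def tr_def[of \<xi>] tr_def[of \<eta>] tr_def[of \<theta>] of_int_add of_int_mult of_int_diff of_int_power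
    using cong_Q_of_int[of 4] by (intro cong_Q_add cong_Q_mult cong_Q_diff cong_Q_power cgs cgD) auto
  moreover have "of_int (lift_form X a b (lrec X 2 X k)) \<in> Q" using dvd by (simp only: of_int_in_Q_iff)
  ultimately have inQ: "poly (of_int_poly f) (zeta m) \<in> Q"
    using Q_diff unfolding cong_Q_def by fastforce
  have nrm: "norm \<xi> = 1" by (rule norm_root_of_unity[OF m(1) roots(1)])
  have "lift_form (2 * Re \<xi>) (2 * Re \<eta>) (2 * Re \<theta>) (2 * Re (\<xi> ^ k)) < 0"
  proof (rule lift_form_neg)
    show "\<bar>2 * Re \<xi>\<bar> \<le> 2" using abs_Re_le_cmod[of \<xi>] nrm by simp
    show "2 * Re \<xi> \<noteq> 0" using nz(1) by (auto simp: complex_eq_iff)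
    \<comment> \<open>A point of the unit circle other than 1 and -1 has real part strictly between
      -1 and 1.\<close>
    define w where "w = \<xi> ^ k"
    have w: "norm w = 1" "w ^ 2 \<noteq> 1" using nrm nz(2) by (simp_all add: w_def norm_power mult.commute flip: power_mult)
    have "\<bar>Re w\<bar> \<noteq> 1"
    proof
      assume "\<bar>Re w\<bar> = 1"
      hence re: "(Re w)\<^sup>2 = 1" by (metis power2_abs power_one)
      moreover have "(Re w)\<^sup>2 + (Im w)\<^sup>2 = 1" using w(1) by (simp add: cmod_def)
      ultimately have "Im w = 0" by simp
      hence "w ^ 2 = 1" using re by (simp add: complex_eq_iff power2_eq_square)
      thus False using w by simp
    qed
    moreover have "\<bar>Re w\<bar> \<le> 1" using abs_Re_le_cmod[of w] w by simp
    ultimately show "\<bar>2 * Re (\<xi> ^ k)\<bar> < 2" unfolding w_def[symmetric] by simp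
  qed
  hence "poly (of_int_poly f) (zeta m) \<noteq> 0"
    unfolding fz tr_def complex_add_cnj lift_form_of_real by simp
  moreover have "norm (poly (of_int_poly f) z) \<le> 160" if z: "z ^ m = 1" for z :: complex
  proof -
    have "norm z = 1" by (rule norm_root_of_unity[OF m(1) z])
    hence "norm (tr (z ^ e)) \<le> 2" for e
      using norm_triangle_ineq[of "z ^ e" "cnj (z ^ e)"] by (simp add: tr_def norm_power)
    thus ?thesis unfolding f[OF z] by (intro norm_lift_form_le)
  qed
  ultimately show ?thesis
    by (intro prime_le_power_of_conjugate_bound[OF m inQ]) simp_all
qed

section \<open>Components of the Markoff graph\<close>

lemma markoff_triples_iff:
  assumes "prime p"
  shows "(x, y, z) \<in> markoff_triples p \<longleftrightarrow>
    x \<in> {0..<int p} \<and> y \<in> {0..<int p} \<and> z \<in> {0..<int p} \<and> (x, y, z) \<noteq> (0, 0, 0) \<and>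
    [x ^ 2 + y ^ 2 + z ^ 2 = 3 * x * y * z] (mod int p)"
proof -
  interpret residues "int p" "GF p"
    by unfold_locales (use prime_gt_1_nat[OF assms] in auto)
  have sq: "a [^]\<^bsub>GF p\<^esub> (2::nat) = a ^ 2 mod int p" if "a \<in> carrier (GF p)" for a
    using that by (simp add: numeral_2_eq_2 res_mult_eq res_one_eq mod_simps power2_eq_square)
  have three: "[(3::nat)] \<cdot>\<^bsub>GF p\<^esub> a = (3 * a) mod int p" if "a \<in> carrier (GF p)" for a
  proof -
    have "[(3::nat)] \<cdot>\<^bsub>GF p\<^esub> a = a \<oplus>\<^bsub>GF p\<^esub> a \<oplus>\<^bsub>GF p\<^esub> a"
      using that by (simp add: numeral_3_eq_3)
    thus ?thesis by (simp add: res_add_eq mod_simps)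
  qed
  have sum3: "x [^]\<^bsub>GF p\<^esub> (2::nat) \<oplus>\<^bsub>GF p\<^esub> y [^]\<^bsub>GF p\<^esub> (2::nat) \<oplus>\<^bsub>GF p\<^esub> z [^]\<^bsub>GF p\<^esub> (2::nat) =
      (x ^ 2 + y ^ 2 + z ^ 2) mod int p"
    if "x \<in> carrier (GF p)" "y \<in> carrier (GF p)" "z \<in> carrier (GF p)"
    by (simp only: sq that res_add_eq mod_add_eq)
  have "[(3::nat)] \<cdot>\<^bsub>GF p\<^esub> (x \<otimes>\<^bsub>GF p\<^esub> y \<otimes>\<^bsub>GF p\<^esub> z) = (3 * x * y * z) mod int p"
    by (subst three) (simp_all add: res_mult_eq mod_simps mult.assoc)
  thus ?thesis
    using sum3 by (auto simp: markoff_triples_def res_carrier_eq res_zero_eq cong_def)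
qed

lemma R2_eq:
  assumes "prime p" "x \<in> {0..<int p}" "y \<in> {0..<int p}" "z \<in> {0..<int p}"
  shows "R2 p (x, y, z) = (x, (3 * x * z - y) mod int p, z)"
proof -
  interpret residues "int p" "GF p"
    by unfold_locales (use prime_gt_1_nat[OF assms(1)] in auto)
  have car: "x \<otimes>\<^bsub>GF p\<^esub> z \<in> carrier (GF p)"
    by (simp add: res_mult_eq)
  have "[(3::nat)] \<cdot>\<^bsub>GF p\<^esub> (x \<otimes>\<^bsub>GF p\<^esub> z) =
      x \<otimes>\<^bsub>GF p\<^esub> z \<oplus>\<^bsub>GF p\<^esub> x \<otimes>\<^bsub>GF p\<^esub> z \<oplus>\<^bsub>GF p\<^esub> x \<otimes>\<^bsub>GF p\<^esub> z"
    using car by (simp add: numeral_3_eq_3)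
  thus ?thesis
    by (simp add: a_minus_def res_neg_eq res_add_eq res_mult_eq mod_simps mult.assoc)
qed

lemma R2_in_markoff_triples:
  assumes p: "prime p" and v: "(x, y, z) \<in> markoff_triples p"
  shows "R2 p (x, y, z) \<in> markoff_triples p"
proof -
  have h: "x \<in> {0..<int p}" "y \<in> {0..<int p}" "z \<in> {0..<int p}" "(x, y, z) \<noteq> (0, 0, 0)"
    and eq: "[x ^ 2 + y ^ 2 + z ^ 2 = 3 * x * y * z] (mod int p)"
    using v markoff_triples_iff[OF p] by auto
  define y' where "y' = (3 * x * z - y) mod int p"
  have cy: "[y' = 3 * x * z - y] (mod int p)" by (simp add: y'_def cong_def)
  have "[x ^ 2 + y' ^ 2 + z ^ 2 - 3 * x * y' * z =
      x ^ 2 + (3 * x * z - y) ^ 2 + z ^ 2 - 3 * x * (3 * x * z - y) * z] (mod int p)"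
    by (intro cong_diff cong_add cong_mult cong_pow cy cong_refl)
  also have "x ^ 2 + (3 * x * z - y) ^ 2 + z ^ 2 - 3 * x * (3 * x * z - y) * z
      = x ^ 2 + y ^ 2 + z ^ 2 - 3 * x * y * z"
    by (simp add: power2_eq_square algebra_simps)
  also have "[\<dots> = 0] (mod int p)" using eq by (simp add: cong_diff_iff_cong_0)
  finally have "[x ^ 2 + y' ^ 2 + z ^ 2 = 3 * x * y' * z] (mod int p)"
    by (simp add: cong_diff_iff_cong_0)
  moreover have "(x, y', z) \<noteq> (0, 0, 0)"
  proof
    assume "(x, y', z) = (0, 0, 0)"
    hence "x = 0" "z = 0" "int p dvd - y" by (auto simp: y'_def)
    hence "int p dvd y" by simp
    with h(2) have "y = 0" by (auto dest: zdvd_imp_le)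
    thus False using h \<open>x = 0\<close> \<open>z = 0\<close> by simp
  qed
  moreover have "y' \<in> {0..<int p}" using prime_gt_0_nat[OF p] by (simp add: y'_def)
  ultimately show ?thesis
    using h R2_eq[OF p h(1-3)] markoff_triples_iff[OF p] by (simp add: y'_def)
qed

lemma coord_perms_in_markoff_triples:
  assumes "prime p" "(x, y, z) \<in> markoff_triples p"
  shows "(x, z, y) \<in> markoff_triples p" "(y, x, z) \<in> markoff_triples p" "(z, y, x) \<in> markoff_triples p"
  using assms(2) unfolding markoff_triples_iff[OF assms(1)] by (auto simp: ac_simps)

lemma finite_markoff_triples:
  assumes "prime p"
  shows "finite (markoff_triples p)"
proof (rule finite_subset)
  show "markoff_triples p \<subseteq> {0..<int p} \<times> {0..<int p} \<times> {0..<int p}"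
    using markoff_triples_iff[OF assms] by auto
qed auto

section \<open>Closure of components under the moves\<close>

text \<open>Adding the arc and its head to \<open>H\<close> keeps it connected, since the tail
  already lies in \<open>H\<close>; by maximality nothing was added.\<close>

lemma max_connected_subgraph_closed:
  assumes H: "pre_digraph.max_subgraph G Digraph_Component.connected H"
    and e: "e \<in> arcs G" and tl: "tail G e \<in> verts H"
  shows "head G e \<in> verts H"
proof -
  have sub: "subgraph H G" and con: "Digraph_Component.connected H"
    and max: "\<And>H'. H' \<noteq> H \<Longrightarrow> subgraph H H' \<Longrightarrow> subgraph H' G \<Longrightarrow> \<not> Digraph_Component.connected H'"
    using H unfolding pre_digraph.max_subgraph_def by blast+
  interpret G: wf_digraph G using sub by (simp add: subgraph_def)
  interpret H: wf_digraph H using sub by (simp add: subgraph_def)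
  have th: "tail H = tail G" "head H = head G" using sub by (auto simp: subgraph_def compatible_def)
  define u w where "u = tail G e" and "w = head G e"
  define H' where "H' = H \<lparr>verts := insert w (verts H), arcs := insert e (arcs H)\<rparr>"
  have H': "verts H' = insert w (verts H)" "arcs H' = insert e (arcs H)" "tail H' = tail G" "head H' = head G"
    by (simp_all add: H'_def th)
  have wf': "wf_digraph H'"
    by unfold_locales (use H' tl H.tail_in_verts H.head_in_verts th in \<open>auto simp: w_def\<close>)
  have sub1: "subgraph H H'"
    unfolding subgraph_def compatible_def using H' th wf' H.wf_digraph_axioms by auto
  have sub2: "subgraph H' G"
    unfolding subgraph_def compatible_def using H' th wf' G.wf_digraph_axioms sub e
    by (auto simp: subgraph_def w_def)
  let ?M = "mk_symmetric H" and ?M' = "mk_symmetric H'"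
  interpret M': pair_wf_digraph ?M' by (rule wf_digraph.wellformed_mk_symmetric[OF wf'])
  interpret M: pair_wf_digraph ?M by (rule H.wellformed_mk_symmetric)
  have subM: "subgraph ?M ?M'" by (rule subgraph_mk_symmetric[OF sub1])
  have uw: "u \<rightarrow>\<^bsub>?M'\<^esub> w" "w \<rightarrow>\<^bsub>?M'\<^esub> u"
    using H' by (auto simp: parcs_mk_symmetric u_def w_def)
  have old: "a \<rightarrow>\<^sup>*\<^bsub>?M'\<^esub> b" if "a \<in> verts H" "b \<in> verts H" for a b
    using that con subM unfolding connected_def strongly_connected_def
    by (auto intro: M'.reachable_mono)
  \<comment> \<open>The tail \<open>u\<close> serves as a hub that every vertex of \<open>H'\<close>
    reaches and is reached from.\<close>
  have toU: "a \<rightarrow>\<^sup>*\<^bsub>?M'\<^esub> u" and fromU: "u \<rightarrow>\<^sup>*\<^bsub>?M'\<^esub> a" if "a \<in> verts H'" for a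
    using that old[OF _ tl] old[OF tl] uw M'.reachable_adjI unfolding H' u_def[symmetric] by auto
  have "Digraph_Component.connected H'"
    unfolding connected_def
  proof (rule strongly_connectedI)
    show "verts (with_proj ?M') \<noteq> {}" using H' by simp
    fix a b assume "a \<in> verts (with_proj ?M')" "b \<in> verts (with_proj ?M')"
    hence "a \<in> verts H'" "b \<in> verts H'" by auto
    thus "a \<rightarrow>\<^sup>*\<^bsub>?M'\<^esub> b" using M'.reachable_trans[OF toU fromU] by blast
  qed
  hence "H' = H" using max sub1 sub2 by blast
  thus ?thesis using H' by (auto simp: w_def)
qed

lemma component_closed:
  assumes H: "connected_component_of H (with_proj (markoff_graph p))"
    and v: "v \<in> verts H" and T: "T \<in> markoff_moves p" and Tv: "T v \<in> markoff_triples p"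
  shows "T v \<in> verts H"
proof -
  have "verts H \<subseteq> markoff_triples p"
    using H unfolding connected_component_of_def pre_digraph.max_subgraph_def subgraph_def
    by (auto simp: markoff_graph_def)
  hence "(v, T v) \<in> arcs (with_proj (markoff_graph p))"
    using v T Tv by (auto simp: markoff_graph_def)
  from max_connected_subgraph_closed[OF H[unfolded connected_component_of_def] this] show ?thesis
    using v by simp
qed

section \<open>Rotation orbits\<close>

definition root_ord :: "complex \<Rightarrow> nat" where
  "root_ord z = (LEAST d. d > 0 \<and> z ^ d = 1)"

lemma root_ord_props:
  assumes "m > 0" "z ^ m = 1"
  shows "root_ord z > 0" "z ^ root_ord z = 1" "root_ord z \<le> m"
    "\<And>k. 0 < k \<Longrightarrow> k < root_ord z \<Longrightarrow> z ^ k \<noteq> 1"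
proof -
  have "root_ord z > 0 \<and> z ^ root_ord z = 1"
    unfolding root_ord_def by (rule LeastI[of _ m]) (use assms in auto)
  thus "root_ord z > 0" "z ^ root_ord z = 1" by auto
  show "root_ord z \<le> m" unfolding root_ord_def by (rule Least_le) (use assms in auto)
  show "z ^ k \<noteq> 1" if "0 < k" "k < root_ord z" for k
    using not_less_Least[of k "\<lambda>d. d > 0 \<and> z ^ d = 1"] that unfolding root_ord_def by auto
qed

text \<open>Let \<open>D\<close> be the least positive number such that at least \<open>D\<close>
  indices have value at most \<open>D\<close>. Two of them share a value, because only
  \<open>D - 1\<close> values from 2 on are available, so L \<le> C F D. By minimality at least half
  of all values exceed \<open>D div 2\<close>, so the sum is at least F D / 4.\<close>

lemma pigeonhole_sum_bound:
  fixes g :: "nat \<Rightarrow> nat" and L C :: real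
  assumes F: "F > 0" and g: "\<And>n. n < F \<Longrightarrow> 2 \<le> g n \<and> g n \<le> F" and C: "C \<ge> 0"
    and L: "\<And>i j. i < j \<Longrightarrow> j < F \<Longrightarrow> g i = g j \<Longrightarrow> L \<le> C * real F * real (g i)"
  shows "L \<le> 4 * C * real (\<Sum>n<F. g n)"
proof -
  define cnt where "cnt D = card {n. n < F \<and> g n \<le> D}" for D
  define P where "P D \<longleftrightarrow> D > 0 \<and> D \<le> cnt D" for D
  have "{n. n < F \<and> g n \<le> F} = {..<F}" using g by auto
  hence PF: "P F" using F by (simp add: P_def cnt_def)
  define D where "D = (LEAST D. P D)"
  have PD: "P D" and DF: "D \<le> F" and min: "\<And>e. e < D \<Longrightarrow> \<not> P e"
    unfolding D_def using LeastI[of P, OF PF] Least_le[of P, OF PF] not_less_Least by auto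
  have D0: "D > 0" using PD by (simp add: P_def)
  have "\<not> inj_on g {n. n < F \<and> g n \<le> D}"
  proof
    assume inj: "inj_on g {n. n < F \<and> g n \<le> D}"
    have "g ` {n. n < F \<and> g n \<le> D} \<subseteq> {2..D}" using g by auto
    from card_mono[OF _ this] card_image[OF inj] have "cnt D \<le> D - 1" by (simp add: cnt_def)
    thus False using PD by (auto simp: P_def)
  qed
  then obtain i j where ij: "i < F" "g i \<le> D" "j < F" "g i = g j" "i \<noteq> j"
    unfolding inj_on_def by auto
  have "L \<le> C * real F * real (g i)"
    using ij L[of i j] L[of j i] by (cases "i < j") auto
  also have "\<dots> \<le> C * real F * real D"
    using ij C by (intro mult_left_mono) auto
  finally have LD: "L \<le> C * (real F * real D)" by (simp add: mult.assoc)
  define e where "e = D div 2"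
  \<comment> \<open>\<open>P\<close> excludes 0, so minimality says nothing for
    \<open>e = 0\<close>; there the lower bound 2 on \<open>g\<close> takes over.\<close>
  have ce: "cnt e \<le> e"
  proof (cases "e = 0")
    case True
    have "{n. n < F \<and> g n \<le> e} = {}" using g True by force
    thus ?thesis unfolding cnt_def by (metis card.empty le0)
  next
    case False
    thus ?thesis using min[of e] D0 by (auto simp: P_def e_def)
  qed
  define B where "B = {n. n < F \<and> g n > e}"
  have part: "{..<F} = {n. n < F \<and> g n \<le> e} \<union> B" by (auto simp: B_def)
  have "F = card {..<F}" by simp
  also have "\<dots> = cnt e + card B"
    unfolding part cnt_def by (rule card_Un_disjoint) (auto simp: B_def)
  finally have "F = cnt e + card B" .
  hence cB: "F - e \<le> card B" using ce by simp
  have "(F - e) * (e + 1) \<le> card B * (e + 1)" using cB by (rule mult_le_mono1)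
  also have "\<dots> = (\<Sum>n\<in>B. e + 1)" by simp
  also have "\<dots> \<le> (\<Sum>n\<in>B. g n)" by (rule sum_mono) (auto simp: B_def)
  also have "\<dots> \<le> (\<Sum>n<F. g n)" by (rule sum_mono2) (auto simp: B_def)
  finally have S: "(F - e) * (e + 1) \<le> (\<Sum>n<F. g n)" .
  have "F * D \<le> (2 * (F - e)) * (2 * (e + 1))"
    by (rule mult_le_mono) (use DF in \<open>auto simp: e_def\<close>)
  hence "F * D \<le> 4 * (\<Sum>n<F. g n)" using S by linarith
  hence "real (F * D) \<le> real (4 * (\<Sum>n<F. g n))" by (simp only: of_nat_le_iff)
  hence "real F * real D \<le> 4 * real (\<Sum>n<F. g n)" by simp
  hence "C * (real F * real D) \<le> C * (4 * real (\<Sum>n<F. g n))" by (rule mult_left_mono[OF _ C])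
  thus ?thesis using LD by (simp add: algebra_simps)
qed

section \<open>The rotation and its period\<close>

text \<open>This is \<open>R2\<close> followed by the exchange of the last two coordinates, a
  composition of moves that fixes \<open>x\<close>.\<close>

definition rot :: "nat \<Rightarrow> int \<times> int \<times> int \<Rightarrow> int \<times> int \<times> int" where
  "rot p = (\<lambda>(x, y, z). (x, z, (3 * x * z - y) mod int p))"

text \<open>What the argument takes from a component: it is nonempty and closed under the moves that
  stay among the triples, which is the condition for an arc of the graph.\<close>

locale markoff_orbit =
  fixes p :: nat and S :: "(int \<times> int \<times> int) set"
  assumes prime_p: "prime p" and S_sub: "S \<subseteq> markoff_triples p" and S_ne: "S \<noteq> {}"
    and S_closed: "v \<in> S \<Longrightarrow> T \<in> markoff_moves p \<Longrightarrow> T v \<in> markoff_triples p \<Longrightarrow> T v \<in> S"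
begin

lemma finite_S: "finite S"
  using finite_markoff_triples[OF prime_p] S_sub by (rule finite_subset[rotated])

lemma S_D:
  assumes "(x, y, z) \<in> S"
  shows "x \<in> {0..<int p}" "y \<in> {0..<int p}" "z \<in> {0..<int p}" "(x, y, z) \<noteq> (0, 0, 0)"
    "[x ^ 2 + y ^ 2 + z ^ 2 = 3 * x * y * z] (mod int p)"
  using assms S_sub markoff_triples_iff[OF prime_p, of x y z] by auto

lemma S_perm:
  assumes "(x, y, z) \<in> S"
  shows "(x, z, y) \<in> S" "(y, x, z) \<in> S" "(z, y, x) \<in> S"
proof -
  have m: "(x, y, z) \<in> markoff_triples p" using assms S_sub by auto
  show "(x, z, y) \<in> S"
    using S_closed[OF assms, of "\<lambda>(x, y, z). (x, z, y)"] coord_perms_in_markoff_triples[OF prime_p m]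
    by (simp add: markoff_moves_def coord_perms_def)
  show "(y, x, z) \<in> S"
    using S_closed[OF assms, of "\<lambda>(x, y, z). (y, x, z)"] coord_perms_in_markoff_triples[OF prime_p m]
    by (simp add: markoff_moves_def coord_perms_def)
  show "(z, y, x) \<in> S"
    using S_closed[OF assms, of "\<lambda>(x, y, z). (z, y, x)"] coord_perms_in_markoff_triples[OF prime_p m]
    by (simp add: markoff_moves_def coord_perms_def)
qed

lemma rot_in_S: "v \<in> S \<Longrightarrow> rot p v \<in> S"
proof (cases v)
  case (fields x y z)
  assume "v \<in> S"
  hence v: "(x, y, z) \<in> S" by (simp add: fields)
  have "R2 p (x, y, z) \<in> S"
    using S_closed[OF v, of "R2 p"] R2_in_markoff_triples[OF prime_p] v S_sub
    by (auto simp: markoff_moves_def)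
  hence "(x, (3 * x * z - y) mod int p, z) \<in> S"
    using R2_eq[OF prime_p S_D(1-3)[OF v]] by simp
  from S_perm(1)[OF this] show ?thesis by (simp add: rot_def fields)
qed

lemma rot_pow_in_S: "v \<in> S \<Longrightarrow> (rot p ^^ k) v \<in> S"
  by (induction k) (auto intro: rot_in_S)

lemma rot_pow:
  assumes "(x, y, z) \<in> S"
  shows "(rot p ^^ k) (x, y, z) =
    (x, lrec (3 * x) y z k mod int p, lrec (3 * x) y z (Suc k) mod int p)"
proof (induction k)
  case 0
  thus ?case using S_D[OF assms] by simp
next
  case (Suc k)
  have "[3 * x * (lrec (3 * x) y z (Suc k) mod int p) - lrec (3 * x) y z k mod int p =
      3 * x * lrec (3 * x) y z (Suc k) - lrec (3 * x) y z k] (mod int p)"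
    by (intro cong_diff cong_mult cong_refl) (simp_all add: cong_def)
  thus ?case using Suc by (simp add: rot_def cong_def)
qed

lemma rot_inj: "inj_on (rot p) S"
proof (rule inj_onI)
  fix v w assume v: "v \<in> S" and w: "w \<in> S" and eq: "rot p v = rot p w"
  obtain x y z x' y' z' where vw: "v = (x, y, z)" "w = (x', y', z')" by (cases v, cases w)
  have e: "x = x'" "z = z'" "(3 * x * z - y) mod int p = (3 * x * z - y') mod int p"
    using eq by (auto simp: rot_def vw)
  have "[3 * x * z - y = 3 * x * z - y'] (mod int p)" using e(3) by (simp only: cong_def)
  from cong_diff[OF cong_refl[of "3 * x * z"] this] have "[y = y'] (mod int p)" by simp
  moreover have "y \<in> {0..<int p}" "y' \<in> {0..<int p}" using S_D(2) v w vw by auto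
  ultimately have "y = y'" by (simp add: cong_def)
  thus "v = w" using e vw by simp
qed

lemma rot_pow_cancel:
  assumes "v \<in> S" "(rot p ^^ (i + d)) v = (rot p ^^ i) v"
  shows "(rot p ^^ d) v = v"
  using assms(2)
proof (induction i)
  case (Suc i)
  hence "rot p ((rot p ^^ (i + d)) v) = rot p ((rot p ^^ i) v)" by simp
  hence "(rot p ^^ (i + d)) v = (rot p ^^ i) v"
    by (rule inj_onD[OF rot_inj]) (intro rot_pow_in_S assms)+
  thus ?case by (rule Suc.IH)
qed simp

definition fiber_card :: "int \<Rightarrow> nat" where
  "fiber_card x = card {v \<in> S. fst v = x}"

lemma fst_rot_pow: "fst ((rot p ^^ k) v) = fst v"
  by (induction k) (auto simp: rot_def split: prod.splits)

text \<open>An injective self-map of a finite set has purely periodic orbits; the triples of one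
  period are distinct and lie over the same first coordinate.\<close>

lemma rot_period:
  assumes v: "v \<in> S"
  obtains T where "T > 0" "(rot p ^^ T) v = v" "inj_on (\<lambda>k. (rot p ^^ k) v) {..<T}"
    "T \<le> fiber_card (fst v)"
proof -
  let ?h = "\<lambda>k. (rot p ^^ k) v"
  have sub: "?h ` A \<subseteq> {w \<in> S. fst w = fst v}" for A
    using rot_pow_in_S[OF v] by (auto simp: image_subset_iff fst_rot_pow)
  have fin: "finite {w \<in> S. fst w = fst v}" using finite_S by simp
  have "\<not> inj_on ?h UNIV"
    using finite_imageD[of ?h UNIV] finite_subset[OF sub fin] by auto
  then obtain i j where ij: "i < j" "?h i = ?h j"
    unfolding inj_on_def by (metis linorder_neqE_nat)
  define P where "P d \<longleftrightarrow> d > 0 \<and> ?h d = v" for d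
  have "P (j - i)" using ij rot_pow_cancel[OF v, of i "j - i"] by (simp add: P_def)
  hence "P (Least P)" and min: "\<And>d. d < Least P \<Longrightarrow> \<not> P d"
    by (auto intro: LeastI dest: not_less_Least)
  hence T: "Least P > 0" "?h (Least P) = v" by (auto simp: P_def)
  have "a = b" if "a < Least P" "b < Least P" "?h a = ?h b" "a < b" for a b
    using that min[of "b - a", OF less_imp_diff_less] rot_pow_cancel[OF v, of a "b - a"]
    by (auto simp: P_def)
  hence inj: "inj_on ?h {..<Least P}"
    unfolding inj_on_def by (metis lessThan_iff linorder_neqE_nat)
  have "Least P \<le> fiber_card (fst v)"
    using card_mono[OF fin sub[of "{..<Least P}"]] card_image[OF inj] by (simp add: fiber_card_def)
  with T inj show ?thesis by (intro that[of "Least P"])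
qed

lemma sum_fiber_card: "(\<Sum>x\<in>fst ` S. fiber_card x) = card S"
proof -
  have "card S = (\<Sum>v\<in>S. 1)" by simp
  also have "\<dots> = (\<Sum>x\<in>fst ` S. \<Sum>v\<in>{v. v \<in> S \<and> fst v = x}. 1)"
    by (rule sum.image_gen[OF finite_S])
  finally show ?thesis by (simp add: fiber_card_def)
qed

section \<open>Traces of rotations modulo p\<close>

text \<open>Scaling by 3 brings the equation to X^2 + Y^2 + Z^2 = X Y Z, in which X is the trace of
  the rotation.\<close>

lemma scaled_markoff:
  assumes "(x, y, z) \<in> S"
  shows "int p dvd (3 * x) ^ 2 + (3 * y) ^ 2 + (3 * z) ^ 2 - 3 * x * (3 * y) * (3 * z)"
proof -
  have "int p dvd x ^ 2 + y ^ 2 + z ^ 2 - 3 * x * y * z"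
    using S_D(5)[OF assms] by (simp add: cong_iff_dvd_diff)
  hence "int p dvd 9 * (x ^ 2 + y ^ 2 + z ^ 2 - 3 * x * y * z)" by (rule dvd_mult)
  also have "9 * (x ^ 2 + y ^ 2 + z ^ 2 - 3 * x * y * z) =
    (3 * x) ^ 2 + (3 * y) ^ 2 + (3 * z) ^ 2 - 3 * x * (3 * y) * (3 * z)"
    by (simp add: power2_eq_square algebra_simps)
  finally show ?thesis .
qed

lemma prime_int: "prime (int p)"
  using prime_p by simp

lemma dvd_coord_iff:
  assumes "a \<in> {0..<int p}"
  shows "int p dvd a \<longleftrightarrow> a = 0"
  by (metis assms atLeastLessThan_iff dvd_0_right order.order_iff_strict zdvd_not_zless)

text \<open>A period \<open>T\<close> turns \<open>lrec_add_diff\<close> into 2 y = D y and 2 z = D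
  z modulo \<open>p\<close>, where D = D_T. If D were not 2, then y = z = 0, and the equation would
  force x = 0.\<close>

lemma dvd_trace_period:
  assumes v: "(x, y, z) \<in> S" and T: "(rot p ^^ T) (x, y, z) = (x, y, z)"
  shows "int p dvd lrec (3 * x) 2 (3 * x) T - 2"
proof (rule ccontr)
  let ?Y = "lrec (3 * x) y z" and ?D = "lrec (3 * x) 2 (3 * x) T"
  assume nd: "\<not> int p dvd ?D - 2"
  have TT: "(rot p ^^ (T + T)) (x, y, z) = (x, y, z)" by (simp add: funpow_add T)
  have r: "y mod int p = y" "z mod int p = z" using S_D[OF v] by auto
  have c: "[?Y T = y] (mod int p)" "[?Y (Suc T) = z] (mod int p)"
     "[?Y (T + T) = y] (mod int p)" "[?Y (Suc (T + T)) = z] (mod int p)"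
    using rot_pow[OF v, of T] rot_pow[OF v, of "T + T"] T TT r unfolding cong_def by auto
  have e: "?Y (T + T) + y = ?D * ?Y T" "?Y (Suc (T + T)) + z = ?D * ?Y (Suc T)"
    using lrec_add_diff[of "3 * x" y z 0 T] lrec_add_diff[of "3 * x" y z 1 T] by simp_all
  have "[?D * y = y + y] (mod int p)"
    using cong_add[OF c(3) cong_refl[of y]] cong_scalar_left[OF c(1), of ?D] unfolding e
    by (metis cong_sym cong_trans)
  hence "int p dvd (?D - 2) * y" by (simp add: cong_iff_dvd_diff algebra_simps)
  hence "int p dvd y" using nd prime_int prime_dvd_mult_iff by blast
  hence y0: "y = 0" using dvd_coord_iff S_D(2)[OF v] by blast
  have "[?D * z = z + z] (mod int p)"
    using cong_add[OF c(4) cong_refl[of z]] cong_scalar_left[OF c(2), of ?D] unfolding e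
    by (metis cong_sym cong_trans)
  hence "int p dvd (?D - 2) * z" by (simp add: cong_iff_dvd_diff algebra_simps)
  hence "int p dvd z" using nd prime_int prime_dvd_mult_iff by blast
  hence z0: "z = 0" using dvd_coord_iff S_D(3)[OF v] by blast
  have "[x ^ 2 = 0] (mod int p)" using S_D(5)[OF v] y0 z0 by simp
  hence "int p dvd x ^ 2" by (simp add: cong_0_iff)
  hence "int p dvd x" by (rule prime_dvd_power[OF prime_int])
  hence "x = 0" using dvd_coord_iff S_D(1)[OF v] by blast
  thus False using y0 z0 S_D(4)[OF v] by simp
qed

text \<open>For X = 2 or X = -2 modulo \<open>p\<close> the number U_T is T up to sign. A period T
  makes \<open>p\<close> divide U_T by \<open>lrec_form\<close>, which is impossible for 0 < T <
  p.\<close>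

lemma not_parabolic:
  assumes v: "(x, y, z) \<in> S" and p: "p > 3" "card S < p"
  shows "\<not> int p dvd (3 * x) ^ 2 - 4"
proof
  assume "int p dvd (3 * x) ^ 2 - 4"
  hence par: "int p dvd (3 * x - 2) * (3 * x + 2)" by (simp add: power2_eq_square algebra_simps)
  obtain T where T: "T > 0" "(rot p ^^ T) (x, y, z) = (x, y, z)" "T \<le> fiber_card x"
    using rot_period[OF v] by auto
  have "fiber_card x \<le> card S" unfolding fiber_card_def by (rule card_mono[OF finite_S]) auto
  hence Tp: "T < p" using T p by simp
  let ?X = "3 * x" and ?a = "3 * y" and ?b = "3 * z"
  let ?U = "lrec ?X 0 1 T" and ?D = "lrec ?X 2 ?X T"
  have two: "\<not> int p dvd 2"
    using p zdvd_imp_le[of "int p" 2] by auto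
  have "y mod int p = y" using S_D[OF v] by auto
  hence "[lrec ?X y z T = y] (mod int p)" using rot_pow[OF v, of T] T unfolding cong_def by auto
  hence Y: "[lrec ?X ?a ?b T = ?a] (mod int p)" by (simp add: lrec_scale cong_scalar_left)
  have D: "[?D = 2] (mod int p)" using dvd_trace_period[OF v T(2)] by (simp add: cong_iff_dvd_diff)
  have "[?a ^ 2 + lrec ?X ?a ?b T ^ 2 - ?D * ?a * lrec ?X ?a ?b T = ?a ^ 2 + ?a ^ 2 - 2 * ?a * ?a] (mod int p)"
    by (intro cong_add cong_diff cong_mult cong_pow Y D cong_refl)
  hence "int p dvd ?U ^ 2 * (?a ^ 2 + ?b ^ 2 - ?X * ?a * ?b)"
    unfolding lrec_form by (simp add: power2_eq_square cong_0_iff)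
  \<comment> \<open>Otherwise the Markoff equation would give X^2 = 0 modulo \<open>p\<close>,
    against X^2 = 4.\<close>
  moreover have "\<not> int p dvd ?a ^ 2 + ?b ^ 2 - ?X * ?a * ?b"
  proof
    assume "int p dvd ?a ^ 2 + ?b ^ 2 - ?X * ?a * ?b"
    from dvd_diff[OF scaled_markoff[OF v] this] have "int p dvd ?X ^ 2" by (simp add: algebra_simps)
    with \<open>int p dvd ?X ^ 2 - 4\<close> have "int p dvd ?X ^ 2 - (?X ^ 2 - 4)" by (rule dvd_diff[rotated])
    hence "int p dvd 2 * 2" by simp
    thus False using two prime_int prime_dvd_mult_iff by blast
  qed
  ultimately have U: "int p dvd ?U" using prime_int prime_dvd_mult_iff prime_dvd_power by blast
  have "int p dvd 3 * x - 2 \<or> int p dvd 3 * x + 2"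
    using par prime_dvd_mult_iff[OF prime_int] by blast
  hence "int p dvd int T"
  proof
    assume "int p dvd 3 * x - 2"
    hence "[?U = lrec 2 0 1 T] (mod int p)" by (intro lrec_cong) (auto simp: cong_iff_dvd_diff)
    thus ?thesis using U by (simp add: lrec_pos2 cong_dvd_iff)
  next
    assume "int p dvd 3 * x + 2"
    hence "[?U = lrec (-2) 0 1 T] (mod int p)" by (intro lrec_cong) (auto simp: cong_iff_dvd_diff)
    hence "int p dvd (-1) ^ Suc T * int T" using U by (simp add: lrec_neg2 cong_dvd_iff)
    thus ?thesis by (cases "even T") auto
  qed
  thus False using T Tp by (auto dest: nat_dvd_not_less)
qed

text \<open>With two coordinates fixed the equation is quadratic in the third; by Vieta its roots
  are \<open>w\<close> and \<open>3 * x * c - w\<close>.\<close>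

lemma card_third_coord_le:
  "card {z. (x, c, z) \<in> S} \<le> 2"
proof (cases "{z. (x, c, z) \<in> S} = {}")
  case False
  then obtain w where w: "(x, c, w) \<in> S" by auto
  have "{z. (x, c, z) \<in> S} \<subseteq> {w, (3 * x * c - w) mod int p}"
  proof
    fix z assume "z \<in> {z. (x, c, z) \<in> S}"
    hence z: "(x, c, z) \<in> S" by simp
    have "[(x ^ 2 + c ^ 2 + z ^ 2) - (x ^ 2 + c ^ 2 + w ^ 2) = 3 * x * c * z - 3 * x * c * w] (mod int p)"
      by (intro cong_diff S_D(5) z w)
    hence "int p dvd ((x ^ 2 + c ^ 2 + z ^ 2) - (x ^ 2 + c ^ 2 + w ^ 2)) - (3 * x * c * z - 3 * x * c * w)"
      by (simp only: cong_iff_dvd_diff)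
    also have "((x ^ 2 + c ^ 2 + z ^ 2) - (x ^ 2 + c ^ 2 + w ^ 2)) - (3 * x * c * z - 3 * x * c * w)
      = (z - w) * (z - (3 * x * c - w))"
      by (simp add: power2_eq_square algebra_simps)
    finally have "int p dvd z - w \<or> int p dvd z - (3 * x * c - w)"
      using prime_int prime_dvd_mult_iff by blast
    moreover have zw: "z mod int p = z" "w mod int p = w" using S_D(3)[OF z] S_D(3)[OF w] by auto
    ultimately show "z \<in> {w, (3 * x * c - w) mod int p}"
      unfolding cong_iff_dvd_diff[symmetric] cong_def by auto
  qed
  from card_mono[OF _ this] show ?thesis
    by (rule order.trans) (auto intro: card_insert_le_m1)
qed simp

section \<open>The logarithmic bound\<close>

text \<open>The factor 16 is 4 * 2 * 2: 4 from the pigeonhole bound, 2 from the common exponent 2 F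
  d of the roots, and 2 from the multiplicity of a value along the orbit.\<close>

lemma ln_le_card_S:
  assumes p: "p > 3" "card S < p"
  shows "ln (real p) \<le> 16 * ln 160 * real (card S)"
proof -
  define N where "N = card S"
  \<comment> \<open>With this choice 2 a b divides \<open>n\<close> for all positive a, b \<le> N,
    so one ring holds every root of unity that occurs.\<close>
  define n :: nat where "n = 2 * (fact N) ^ 2"
  have n0: "n > 0" by (simp add: n_def)
  obtain Q where "prime_over n p Q" using prime_over_exists[OF n0 prime_p] by blast
  then interpret prime_over n p Q .
  define A where "A = fst ` S"
  have A: "finite A" "A \<noteq> {}" using finite_S S_ne by (auto simp: A_def)
  have fiber_le: "fiber_card x \<le> N" for x
    unfolding fiber_card_def N_def by (rule card_mono[OF finite_S]) auto
  have dvd_n: "2 * a * b dvd n" if "0 < a" "a \<le> N" "0 < b" "b \<le> N" for a b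
    using that unfolding n_def by (simp add: power2_eq_square mult.assoc mult_dvd_mono dvd_fact)
  have ex: "\<forall>x\<in>A. \<exists>r. \<exists>\<xi> y z T. r = (\<xi>, y, z, T) \<and> (x, y, z) \<in> S \<and> T > 0 \<and> T \<le> fiber_card x \<and>
     inj_on (\<lambda>k. (rot p ^^ k) (x, y, z)) {..<T} \<and> \<xi> ^ T = 1 \<and> cong_Q (of_int (3 * x)) (\<xi> + cnj \<xi>)"
  proof
    fix x assume "x \<in> A"
    then obtain y z where v: "(x, y, z) \<in> S" by (auto simp: A_def)
    obtain T where T: "T > 0" "(rot p ^^ T) (x, y, z) = (x, y, z)"
      "inj_on (\<lambda>k. (rot p ^^ k) (x, y, z)) {..<T}" "T \<le> fiber_card x"
      using rot_period[OF v] by (metis fst_conv)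
    have "T dvd n" using dvd_n[of T 1] T fiber_le[of x] by (auto elim: dvd_trans[rotated])
    from ex_root_of_unity_cong_Q[OF T(1) this dvd_trace_period[OF v T(2)]]
    show "\<exists>r. \<exists>\<xi> y z T. r = (\<xi>, y, z, T) \<and> (x, y, z) \<in> S \<and> T > 0 \<and> T \<le> fiber_card x \<and>
     inj_on (\<lambda>k. (rot p ^^ k) (x, y, z)) {..<T} \<and> \<xi> ^ T = 1 \<and> cong_Q (of_int (3 * x)) (\<xi> + cnj \<xi>)"
      using v T by blast
  qed
  obtain r where r: "\<forall>x\<in>A. \<exists>\<xi> y z T. r x = (\<xi>, y, z, T) \<and> (x, y, z) \<in> S \<and> T > 0 \<and> T \<le> fiber_card x \<and>
     inj_on (\<lambda>k. (rot p ^^ k) (x, y, z)) {..<T} \<and> \<xi> ^ T = 1 \<and> cong_Q (of_int (3 * x)) (\<xi> + cnj \<xi>)"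
    using bchoice[OF ex] by blast
  define xi where "xi x = fst (r x)" for x
  \<comment> \<open>The square matters: the relation at distance \<open>k\<close> needs xi^k to
    differ from both 1 and -1.\<close>
  define f where "f x = root_ord (xi x ^ 2)" for x
  have xi: "\<exists>y z T. (x, y, z) \<in> S \<and> T > 0 \<and> f x \<le> T \<and> T \<le> fiber_card x \<and> inj_on (\<lambda>k. (rot p ^^ k) (x, y, z)) {..<T}"
    "xi x ^ (2 * f x) = 1" "f x > 0" "f x \<le> fiber_card x" "cong_Q (of_int (3 * x)) (xi x + cnj (xi x))"
    "xi x * cnj (xi x) = 1" "\<And>k. 0 < k \<Longrightarrow> k < f x \<Longrightarrow> xi x ^ (2 * k) \<noteq> 1" if "x \<in> A" for x
  proof -
    obtain y z T where h: "(x, y, z) \<in> S" "T > 0" "T \<le> fiber_card x"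
     "inj_on (\<lambda>k. (rot p ^^ k) (x, y, z)) {..<T}" "xi x ^ T = 1" "cong_Q (of_int (3 * x)) (xi x + cnj (xi x))"
      using bspec[OF r \<open>x \<in> A\<close>] unfolding xi_def by force
    have "(xi x ^ 2) ^ T = (xi x ^ T) ^ 2" by (simp flip: power_mult add: mult.commute)
    hence "(xi x ^ 2) ^ T = 1" using h by simp
    note o = root_ord_props[OF h(2) this, folded f_def]
    show "\<exists>y z T. (x, y, z) \<in> S \<and> T > 0 \<and> f x \<le> T \<and> T \<le> fiber_card x \<and> inj_on (\<lambda>k. (rot p ^^ k) (x, y, z)) {..<T}"
      using h o(3) by blast
    show "xi x ^ (2 * f x) = 1" "f x > 0" "f x \<le> fiber_card x"
      "\<And>k. 0 < k \<Longrightarrow> k < f x \<Longrightarrow> xi x ^ (2 * k) \<noteq> 1"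
      using o h by (auto simp: power_mult)
    show "cong_Q (of_int (3 * x)) (xi x + cnj (xi x))" by fact
    show "xi x * cnj (xi x) = 1" by (rule cnj_root_of_unity[OF h(2,5)])
  qed
  \<comment> \<open>Order 1 would mean that the root is 1 or -1, the parabolic case.\<close>
  have f_ge2: "f x \<ge> 2" if x: "x \<in> A" for x
  proof (rule ccontr)
    assume "\<not> f x \<ge> 2"
    hence "f x = 1" using xi(3)[OF x] by simp
    hence "xi x ^ 2 = 1" using xi(2)[OF x] by simp
    hence "xi x = 1 \<or> xi x = -1" by (simp add: power2_eq_1_iff)
    hence "(xi x + cnj (xi x)) ^ 2 = 4" by auto
    hence "of_int ((3 * x) ^ 2 - 4) \<in> Q"
      using cong_Q_diff[OF cong_Q_power[OF xi(5)[OF x], of 2] cong_Q_of_int[of 4]] by (simp add: cong_Q_def)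
    hence "int p dvd (3 * x) ^ 2 - 4" by (simp only: of_int_in_Q_iff)
    moreover obtain y z where "(x, y, z) \<in> S" using x by (auto simp: A_def)
    ultimately show False using not_parabolic p by blast
  qed
  \<comment> \<open>Order 2 means xi^2 = -1, so that 3x lifts to 0, the case that
    \<open>lift_form_neg\<close> does not cover.\<close>
  have f_ge3: "f x \<ge> 3 \<longleftrightarrow> xi x + cnj (xi x) \<noteq> 0" if x: "x \<in> A" for x
  proof -
    have "xi x * (xi x + cnj (xi x)) = xi x ^ 2 + 1"
      using xi(6)[OF x] by (simp add: algebra_simps power2_eq_square)
    moreover have "xi x \<noteq> 0" using xi(6)[OF x] by auto
    ultimately have 1: "xi x + cnj (xi x) = 0 \<longleftrightarrow> xi x ^ 2 + 1 = 0" by (metis mult_eq_0_iff)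
    have "f x = 2 \<longleftrightarrow> xi x ^ 2 + 1 = 0"
    proof
      assume "f x = 2"
      hence "xi x ^ (2 * 2) = 1" "xi x ^ (2 * 1) \<noteq> 1" using xi(2)[OF x] xi(7)[OF x, of 1] by auto
      hence "(xi x ^ 2 - 1) * (xi x ^ 2 + 1) = 0" "xi x ^ 2 - 1 \<noteq> 0"
        by (simp_all add: algebra_simps power2_eq_square power4_eq_xxxx)
      thus "xi x ^ 2 + 1 = 0" by (metis mult_eq_0_iff)
    next
      assume "xi x ^ 2 + 1 = 0"
      hence "xi x ^ 2 = -1" by (simp add: eq_neg_iff_add_eq_0)
      hence "xi x ^ (2 * 2) = 1" by (simp only: power_mult) simp
      thus "f x = 2" using xi(7)[OF x, of 2] f_ge2[OF x] by force
    qed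
    thus ?thesis using 1 f_ge2[OF x] by auto
  qed
  obtain x0 where x0: "x0 \<in> A" and max: "\<And>x. x \<in> A \<Longrightarrow> f x \<le> f x0"
    using finite_imageI[OF A(1), of f] A(2) Max_in[of "f ` A"] Max_ge[of "f ` A"] by fastforce
  define F where "F = f x0"
  \<comment> \<open>Some coordinate of a triple is nonzero, and a permutation moves it to the first
    place; its lift is then not 0.\<close>
  have F3: "F \<ge> 3"
  proof -
    obtain x y z where v: "(x, y, z) \<in> S" using S_ne by auto
    have "x \<in> A" "y \<in> A" "z \<in> A" using v S_perm[OF v] by (auto simp: A_def rev_image_eqI)
    then obtain w where w: "w \<in> A" "w \<noteq> 0" using S_D(4)[OF v] by auto
    then obtain y' z' where "(w, y', z') \<in> S" by (auto simp: A_def)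
    hence "\<not> int p dvd w" using dvd_coord_iff S_D(1) w(2) by blast
    moreover have "\<not> int p dvd 3" using p zdvd_imp_le[of "int p" 3] by auto
    ultimately have "\<not> int p dvd 3 * w" using prime_int prime_dvd_mult_iff by blast
    hence "of_int (3 * w) \<notin> Q" by (simp only: of_int_in_Q_iff) simp
    hence "xi w + cnj (xi w) \<noteq> 0" using xi(5)[OF w(1)] by (auto simp: cong_Q_def)
    hence "f w \<ge> 3" using f_ge3[OF w(1)] by simp
    thus ?thesis using max[OF w(1)] by (simp add: F_def)
  qed
  obtain y z T where v: "(x0, y, z) \<in> S" and FT: "F \<le> T"
    and inj: "inj_on (\<lambda>k. (rot p ^^ k) (x0, y, z)) {..<T}"
    using xi(1)[OF x0] unfolding F_def by blast
  define w where "w k = lrec (3 * x0) y z k mod int p" for k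
  have rw: "(rot p ^^ k) (x0, y, z) = (x0, w k, w (Suc k))" for k
    unfolding w_def by (rule rot_pow[OF v])
  have wS: "(x0, w k, w (Suc k)) \<in> S" for k
    using rot_pow_in_S[OF v, of k] rw by simp
  have wA: "w k \<in> A" for k
    using S_perm(2)[OF wS[of k]] by (auto simp: A_def rev_image_eqI)
  have key: "ln (real p) \<le> (2 * ln 160) * real F * real (f (w i))"
    if ij: "i < j" "j < F" "f (w i) = f (w j)" for i j
  proof -
    define d where "d = f (w i)"
    define k where "k = j - i"
    \<comment> \<open>\<open>xi x0\<close> is a root of unity of exponent 2 F and the roots of the
      other two coordinates have exponent 2 d, so all three are \<open>m\<close>-th roots.\<close>
    define m where "m = 2 * F * d"
    let ?X = "3 * x0" and ?a = "3 * w i" and ?b = "3 * w (Suc i)"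
    let ?D = "lrec ?X 2 ?X k"
    have d0: "d > 0" "d \<le> N" unfolding d_def using xi(3,4)[OF wA[of i]] fiber_le order.trans by blast+
    have F0: "F > 0" "F \<le> N" unfolding F_def using xi(3,4)[OF x0] fiber_le order.trans by blast+
    have m: "m > 0" "m dvd n" using d0 F0 dvd_n[of F d] by (simp_all add: m_def)
    have "(x0, w j, w (Suc j)) = (rot p ^^ (k + i)) (x0, y, z)" using rw[of j] ij by (simp add: k_def)
    also have "\<dots> = (rot p ^^ k) (x0, w i, w (Suc i))" by (simp add: funpow_add rw)
    also have "\<dots> = (x0, lrec ?X (w i) (w (Suc i)) k mod int p, lrec ?X (w i) (w (Suc i)) (Suc k) mod int p)"
      by (rule rot_pow[OF wS])
    finally have "[w j = lrec ?X (w i) (w (Suc i)) k] (mod int p)" by (simp add: cong_def)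
    hence wj: "[3 * w j = lrec ?X ?a ?b k] (mod int p)" by (simp add: lrec_scale cong_scalar_left)
    have "[lift_form ?X ?a (3 * w j) ?D = lift_form ?X ?a (lrec ?X ?a ?b k) ?D] (mod int p)"
      unfolding lift_form_def by (intro cong_add cong_diff cong_mult cong_pow cong_refl wj)
    also have "lift_form ?X ?a (lrec ?X ?a ?b k) ?D =
        (?D ^ 2 - 4) * (?X ^ 2 + ?a ^ 2 + ?b ^ 2 - ?X * ?a * ?b)"
      unfolding lift_form_def by (rule lrec_form_multiple)
    also have "[\<dots> = 0] (mod int p)"
      using dvd_mult[OF scaled_markoff[OF wS[of i]]] by (simp add: cong_0_iff)
    finally have dv: "int p dvd lift_form ?X ?a (3 * w j) ?D" by (simp only: cong_0_iff)
    have "real p \<le> 160 ^ m"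
    proof (rule root_order_bound[OF m _ _ _ xi(5)[OF x0] xi(5)[OF wA[of i]] xi(5)[OF wA[of j]] dv])
      have m': "m = (2 * F) * d" "m = (2 * d) * F" by (simp_all add: m_def)
      show "xi x0 ^ m = 1" using xi(2)[OF x0] unfolding m'(1) power_mult F_def by simp
      show "xi (w i) ^ m = 1" using xi(2)[OF wA[of i]] unfolding m'(2) power_mult d_def by simp
      show "xi (w j) ^ m = 1" using xi(2)[OF wA[of j]] unfolding m'(2) power_mult d_def ij by simp
      show "xi x0 + cnj (xi x0) \<noteq> 0" using f_ge3[OF x0] F3 by (simp add: F_def)
      show "xi x0 ^ (2 * k) \<noteq> 1" using xi(7)[OF x0, of k] ij by (simp add: k_def F_def)
    qed
    hence "ln (real p) \<le> ln (160 ^ m)" using p by simp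
    also have "\<dots> = real m * ln 160" by (simp add: ln_realpow)
    finally show ?thesis by (simp add: m_def d_def mult_ac)
  qed
  have "ln (real p) \<le> 4 * (2 * ln 160) * real (\<Sum>k<F. f (w k))"
  proof (rule pigeonhole_sum_bound)
    show "2 \<le> f (w k) \<and> f (w k) \<le> F" for k
      using f_ge2[OF wA] max[OF wA] by (simp add: F_def)
  qed (use F3 key in auto)
  also have "(\<Sum>k<F. f (w k)) \<le> 2 * N"
  proof -
    have "(\<Sum>k<F. f (w k)) = (\<Sum>c\<in>w ` {..<F}. \<Sum>k\<in>{k. k \<in> {..<F} \<and> w k = c}. f (w k))"
      by (rule sum.image_gen) simp
    also have "\<dots> \<le> (\<Sum>c\<in>w ` {..<F}. 2 * fiber_card c)"
    proof (rule sum_mono)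
      fix c assume "c \<in> w ` {..<F}"
      hence cA: "c \<in> A" using wA by auto
      let ?K = "{k. k \<in> {..<F} \<and> w k = c}"
      \<comment> \<open>Below \<open>F \<le> T\<close> the triples of the orbit are distinct; those
        with index in \<open>?K\<close> share \<open>x0\<close> and \<open>c\<close>, so the third
        coordinate tells them apart.\<close>
      have "inj_on (\<lambda>k. w (Suc k)) ?K"
      proof (rule inj_onI)
        fix a b assume "a \<in> ?K" "b \<in> ?K" "w (Suc a) = w (Suc b)"
        thus "a = b" using inj_onD[OF inj, of a b] rw FT by auto
      qed
      moreover have "(\<lambda>k. w (Suc k)) ` ?K \<subseteq> {z. (x0, c, z) \<in> S}" using wS by auto
      moreover have "finite {z. (x0, c, z) \<in> S}"
        by (rule finite_subset[OF _ finite_imageI[OF finite_S, of "\<lambda>(x, y, z). z"]]) force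
      ultimately have "card ?K \<le> card {z. (x0, c, z) \<in> S}" by (rule card_inj_on_le)
      hence K: "card ?K \<le> 2" using card_third_coord_le[of x0 c] by linarith
      have "(\<Sum>k\<in>?K. f (w k)) = card ?K * f c" by simp
      also have "\<dots> \<le> 2 * fiber_card c" by (rule mult_le_mono[OF K xi(4)[OF cA]])
      finally show "(\<Sum>k\<in>?K. f (w k)) \<le> 2 * fiber_card c" .
    qed
    also have "\<dots> = 2 * (\<Sum>c\<in>w ` {..<F}. fiber_card c)" by (simp add: sum_distrib_left)
    also have "(\<Sum>c\<in>w ` {..<F}. fiber_card c) \<le> (\<Sum>c\<in>A. fiber_card c)"
      by (rule sum_mono2[OF A(1)]) (use wA in auto)
    also have "\<dots> = N" unfolding A_def N_def by (rule sum_fiber_card)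
    finally show ?thesis by simp
  qed
  finally show ?thesis by (simp add: N_def)
qed

end

section \<open>From closed sets to components\<close>

lemma ln_160_ge_1: "ln (160::real) \<ge> 1"
  using exp_le by (subst ln_ge_iff) auto

lemma ln_le_card_component:
  assumes p: "prime p" and H: "connected_component_of H (with_proj (markoff_graph p))"
  shows "card (verts H) \<ge> 1" "ln (real p) \<le> 16 * ln 160 * real (card (verts H))"
proof -
  have sub: "subgraph H (with_proj (markoff_graph p))" and con: "Digraph_Component.connected H"
    using H unfolding connected_component_of_def pre_digraph.max_subgraph_def by auto
  interpret markoff_orbit p "verts H"
  proof
    show "verts H \<subseteq> markoff_triples p" using sub by (auto simp: subgraph_def markoff_graph_def)
    show "verts H \<noteq> {}" using con by (auto simp: connected_def strongly_connected_def)
  qed (use p component_closed[OF H] in auto)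
  show N1: "card (verts H) \<ge> 1" using finite_S S_ne by (simp add: Suc_le_eq card_gt_0_iff)
  show "ln (real p) \<le> 16 * ln 160 * real (card (verts H))"
  proof (cases "p > 3 \<and> card (verts H) < p")
    case True
    thus ?thesis using ln_le_card_S by simp
  next
    \<comment> \<open>Here p \<le> 3 or the component has at least p vertices, and ln p \<le> p - 1
      is enough.\<close>
    case False
    have "ln (real p) \<le> real p - 1" using prime_gt_0_nat[OF p] by (intro ln_le_minus_one) simp
    also have "\<dots> \<le> 16 * 1 * real (card (verts H))" using False N1 by auto
    also have "\<dots> \<le> 16 * ln 160 * real (card (verts H))"
      using ln_160_ge_1 by (intro mult_right_mono mult_left_mono) auto
    finally show ?thesis .
  qed
qed

theorem theorem1p3:
  shows "\<exists>c::real. c > 0 \<and>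
    (\<forall>p::nat. prime p \<longrightarrow>
      (\<forall>H. connected_component_of H (with_proj (markoff_graph p)) \<longrightarrow>
        real (card (verts H)) \<ge> c * ln (real p) powr (7 / 9)))"
proof (intro exI[of _ "1 / (16 * ln 160)"] conjI allI impI)
  show "1 / (16 * ln 160) > (0::real)" using ln_160_ge_1 by simp
  fix p :: nat and H :: "(int \<times> int \<times> int, (int \<times> int \<times> int) \<times> (int \<times> int \<times> int)) pre_digraph"
  assume p: "prime p" and H: "connected_component_of H (with_proj (markoff_graph p))"
  define N where "N = card (verts H)"
  have N1: "N \<ge> 1" and lnp: "ln (real p) \<le> 16 * ln 160 * real N"
    using ln_le_card_component[OF p H] by (simp_all add: N_def)
  \<comment> \<open>For ln p \<ge> 1 the power is at most ln p itself; for ln p < 1 it is at most 1,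
    and N is at least 1.\<close>
  have "ln (real p) powr (7 / 9) \<le> 16 * ln 160 * real N"
  proof (cases "ln (real p) \<ge> 1")
    case True
    hence "ln (real p) powr (7 / 9) \<le> ln (real p) powr 1" by (intro powr_mono) auto
    thus ?thesis using lnp True by simp
  next
    case False
    have "ln (real p) powr (7 / 9) \<le> 1 powr (7 / 9)"
      using False prime_gt_0_nat[OF p] by (intro powr_mono2) auto
    also have "\<dots> \<le> 16 * 1 * real N" using N1 by simp
    also have "\<dots> \<le> 16 * ln 160 * real N"
      using ln_160_ge_1 by (intro mult_right_mono mult_left_mono) auto
    finally show ?thesis .
  qed
  thus "1 / (16 * ln 160) * ln (real p) powr (7 / 9) \<le> real (card (verts H))"
    using ln_160_ge_1 by (simp add: N_def field_simps)
qed

end
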